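(* Let $q\ge 1$ be a fixed integer and let $v_1,\dots,v_q\in\mathbb{R}^q$, $v_l=(v_{l1},\dots,v_{lq})$, be fixed pairwise distinct vectors such that the $q\times q$ matrix $V=(v_{li})_{l,i=1}^q$ satisfies $\det V\ne 0$. For each $n\ge 1$ let $N=qn$ and consider the linear regression model $y_j=\sum_{i=1}^q\theta_i x_{ji}+\epsilon_j$, $j=1,\dots,N$, where $\theta=(\theta_1,\dots,\theta_q)\in\mathbb{R}^q$ is an unknown parameter, the errors $\epsilon_j$ are i.i.d. random variables with distribution function $F$, and the design is as follows: $\{1,\dots,N\}$ is the disjoint union of sets $I_1,\dots,I_q$ with $\operatorname{card}(I_l)=n$, and $(x_{j1},\dots,x_{jq})=v_l$ for all $j\in I_l$, $l=1,\dots,q$. Let $Z_{nl}=\max_{j\in I_l}\epsilon_j$, $W_{nl}=\min_{j\in I_l}\epsilon_j$, $R_{nl}=Z_{nl}-W_{nl}$, $Q_{nl}=\frac{Z_{nl}+W_{nl}}{2}$. Let $\widehat\theta=(\widehat\theta_1,\dots,\widehat\theta_q)$ be the minimax estimator of $\theta$ and $\widehat\Delta=\Delta(\widehat\theta)=\min_{\tau\in\mathbb{R}^q}\Delta(\tau)$, where $\Delta(\tau)=\max_{1\le j\le N}\bigl|y_j-\sum_{i=1}^q\tau_i x_{ji}\bigr|$. Then: (i) $$\widehat\Delta=\frac12\max_{1\le l\le q}R_{nl},$$ $$\widehat\theta_i-\theta_i=\frac{\det VQ_{(i)}}{\det V},\qquad i=1,\dots,q,$$ where the matrix $VQ_{(i)}$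 is obtained from $V$ by replacing its $i$th column by the column $(Q_{n1},\dots,Q_{nq})^T$. (ii) Assume additionally that the random variables $\epsilon_j$ are symmetric ($\epsilon_j$ and $-\epsilon_j$ have the same distribution) and that there are constants $b_n>0$ and $a_n\in\mathbb{R}$ such that $b_n(\max_{1\le j\le n}\epsilon_j-a_n)$ converges in distribution, as $n\to\infty$, to a random variable with distribution function $G$, where $G$ is one of the extreme value distribution functions $\Phi_\alpha$ ($\alpha>0$), $\Psi_\alpha$ ($\alpha>0$), $\Lambda$. Then $$\lim_{n\to\infty}\mathbb{P}\bigl(2b_n(\widehat\Delta-a_n)<x\bigr)=\bigl(G\star G(x)\bigr)^q,\qquad G\star G(x)=\int_{-\infty}^{\infty}G(x-y)\,dG(y),$$ and, for each $i=1,\dots,q$, as $n\to\infty$, $$2b_n(\widehat\theta_i-\theta_i)\xrightarrow{D}\frac{\det V\zeta_{(i)}}{\det V},$$ where the matrix $V\zeta_{(i)}$ is obtained from $V$ by replacing its $i$th column by the column $(\zeta_1-\zeta'_1,\dots,\zeta_q-\zeta'_q)^T$, and all the random variables $\zeta_1,\dots,\zeta_q,\zeta'_1,\dots,\zeta'_q$ are independent and have distribution function $G$.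
   Context: A minimax estimator (MME) of $\theta$ by the observations $y_1,\dots,y_N$ is a random vector $\widehat\theta$ such that $\Delta(\widehat\theta)=\min_{\tau\in\mathbb{R}^q}\Delta(\tau)$. The extreme value distribution functions are: $\Phi_\alpha(x)=0$ for $x\le 0$ and $\Phi_\alpha(x)=\exp(-x^{-\alpha})$ for $x>0$ ($\alpha>0$); $\Psi_\alpha(x)=\exp(-(-x)^\alpha)$ for $x\le 0$ and $\Psi_\alpha(x)=1$ for $x>0$ ($\alpha>0$); $\Lambda(x)=\exp(-e^{-x})$, $x\in\mathbb{R}$. The notation $\xrightarrow{D}$ means convergence in distribution.
   Formalization: The minimax estimator is generally not unique for q ≥ 2; the formula for Δ̂ is proved for every minimax estimator, while the determinant formula and the limit law of θ̂_i are proved for one suitable minimax estimator (the same for all i), not for every one. *)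

theory Defs
  imports "HOL-Probability.Probability"
begin

definition max_residual :: "nat \<Rightarrow> (nat \<Rightarrow> real^'q) \<Rightarrow> (nat \<Rightarrow> real) \<Rightarrow> real^'q \<Rightarrow> real" where
  "max_residual N x y \<tau> = Max ((\<lambda>j. \<bar>y j - (\<Sum>i\<in>UNIV. \<tau> $ i * x j $ i)\<bar>) ` {1..N})"

(* A minimax estimator is a measurable function of the observations y 1, ..., y N whose value
   minimises the maximal residual at every sample point.  It need not be unique. *)
definition minimax_estimator ::
  "'a measure \<Rightarrow> nat \<Rightarrow> (nat \<Rightarrow> real^'q) \<Rightarrow> (nat \<Rightarrow> 'a \<Rightarrow> real) \<Rightarrow> ('a \<Rightarrow> real^'q) \<Rightarrow> bool" where
  "minimax_estimator M N x y T \<longleftrightarrow>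
     (\<exists>g \<in> borel_measurable (Pi\<^sub>M {1..N} (\<lambda>_. borel)).
        \<forall>\<omega>\<in>space M. T \<omega> = g (\<lambda>j\<in>{1..N}. y j \<omega>)) \<and>
     (\<forall>\<omega>\<in>space M. \<forall>\<tau>.
        max_residual N x (\<lambda>j. y j \<omega>) (T \<omega>) \<le> max_residual N x (\<lambda>j. y j \<omega>) \<tau>)"

definition sample_range :: "(nat \<Rightarrow> real) \<Rightarrow> nat set \<Rightarrow> real" where
  "sample_range e J = Max (e ` J) - Min (e ` J)"

definition sample_midrange :: "(nat \<Rightarrow> real) \<Rightarrow> nat set \<Rightarrow> real" where
  "sample_midrange e J = (Max (e ` J) + Min (e ` J)) / 2"

definition replace_column :: "real^'q^'q \<Rightarrow> 'q \<Rightarrow> ('q \<Rightarrow> real) \<Rightarrow> real^'q^'q" where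
  "replace_column V i c = (\<chi> l k. if k = i then c l else V $ l $ k)"

definition frechet_df :: "real \<Rightarrow> real \<Rightarrow> real" where
  "frechet_df \<alpha> x = (if x \<le> 0 then 0 else exp (- (x powr (- \<alpha>))))"

definition weibull_df :: "real \<Rightarrow> real \<Rightarrow> real" where
  "weibull_df \<alpha> x = (if x \<le> 0 then exp (- ((- x) powr \<alpha>)) else 1)"

definition gumbel_df :: "real \<Rightarrow> real" where
  "gumbel_df x = exp (- exp (- x))"

definition extreme_value_df :: "(real \<Rightarrow> real) \<Rightarrow> bool" where
  "extreme_value_df G \<longleftrightarrow>
     (\<exists>\<alpha>>0. G = frechet_df \<alpha>) \<or> (\<exists>\<alpha>>0. G = weibull_df \<alpha>) \<or> G = gumbel_df"

definition df_self_convolution :: "(real \<Rightarrow> real) \<Rightarrow> real \<Rightarrow> real" where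
  "df_self_convolution G x = (LINT y|interval_measure G. G (x - y))"

end

theory Submission
  imports Defs "HOL-Real_Asymp.Real_Asymp"
begin

text \<open>
  On block \<open>l\<close> the fitted value \<open>c\<^sub>l = (V \<tau>)\<^sub>l\<close> is constant, so the largest residual on the block is at
  least half the range of the observations there, with equality exactly when \<open>c\<^sub>l\<close> is their midrange.
  Since \<open>V\<close> is invertible the \<open>c\<^sub>l\<close> can be chosen freely: fitting all midranges at once is optimal,
  and Cramer's rule expresses the resulting \<open>\<tau>\<close>. Passing from the observations to the errors shifts
  each block by \<open>(V \<theta>)\<^sub>l\<close>; this leaves ranges unchanged and moves midranges by the same amount.

  For the limit laws put \<open>X = b\<^sub>n (Z - a\<^sub>n)\<close> and \<open>Y = b\<^sub>n (- W - a\<^sub>n)\<close> for the maximum \<open>Z\<close> and minimum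
  \<open>W\<close> of a block. The quantities of interest are \<open>b\<^sub>n (R - 2 a\<^sub>n) = X + Y\<close> and \<open>2 b\<^sub>n Q = X - Y\<close>.
  By symmetry \<open>X\<close> and \<open>Y\<close> have the same law, and they are asymptotically independent: with
  \<open>f = F (a\<^sub>n + u / b\<^sub>n)\<close> and \<open>g = F (a\<^sub>n + w / b\<^sub>n)\<close> one has
  \<open>P (X \<le> u, Y \<le> w) = (max 0 (f + g - 1))\<^sup>n\<close>, whereas \<open>P (X \<le> u) P (Y \<le> w) = (f g)\<^sup>n\<close>, and the two bases
  differ by at most \<open>(1 - f) (1 - g)\<close>, which is of order \<open>1/n\<^sup>2\<close> unless the limit is \<open>0\<close>
  (\<open>power_add_minus_one_tendsto\<close>).

  Convergence of the joint distribution functions is turned into convergence of the characteristic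
  functions of \<open>p X + q Y\<close> by using weak convergence on the line twice, each time under a measure
  reweighted by a function of the other variable (\<open>weighted_weak_conv\<close>). Levy's continuity theorem
  then gives the limit of \<open>X + Y\<close>, whose law is atomless, and, the blocks being independent, the limit
  of any linear combination of the differences \<open>X - Y\<close> of the individual blocks; the estimation error
  is such a combination because the Cramer quotient is linear in the replaced column.
\<close>

section \<open>Deterministic solution of the minimax problem\<close>

text \<open>
  The two extreme observations lie a full range apart, so no centre is closer than half the range to both.
\<close>

lemma half_sample_range_le:
  assumes "finite J" "J \<noteq> {}" "\<And>j. j \<in> J \<Longrightarrow> \<bar>e j - c\<bar> \<le> r"
  shows "sample_range e J / 2 \<le> r"
proof -
  have "Max (e ` J) \<in> e ` J" "Min (e ` J) \<in> e ` J"
    using assms(1,2) by auto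
  then obtain j k where jk: "j \<in> J" "Max (e ` J) = e j" "k \<in> J" "Min (e ` J) = e k"
    by auto
  then show ?thesis
    using assms(3)[OF jk(1)] assms(3)[OF jk(3)] unfolding sample_range_def jk(2,4)
    by (simp only: abs_le_iff) (simp add: field_simps)
qed

lemma abs_diff_sample_midrange_le:
  assumes "finite J" "j \<in> J"
  shows "\<bar>e j - sample_midrange e J\<bar> \<le> sample_range e J / 2"
proof -
  have "e j \<le> Max (e ` J)" "Min (e ` J) \<le> e j"
    using assms by auto
  then show ?thesis
    unfolding sample_midrange_def sample_range_def by (simp add: abs_le_iff field_simps)
qed

lemma Max_image_add_left:
  fixes e :: "nat \<Rightarrow> real"
  assumes "finite J" "J \<noteq> {}"
  shows "Max ((\<lambda>j. c + e j) ` J) = c + Max (e ` J)"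
  using mono_Max_commute[of "\<lambda>z. c + z" "e ` J"] assms by (simp add: mono_def image_image)

lemma Min_image_add_left:
  fixes e :: "nat \<Rightarrow> real"
  assumes "finite J" "J \<noteq> {}"
  shows "Min ((\<lambda>j. c + e j) ` J) = c + Min (e ` J)"
  using mono_Min_commute[of "\<lambda>z. c + z" "e ` J"] assms by (simp add: mono_def image_image)

lemma sample_range_shift:
  assumes "finite J" "J \<noteq> {}" "\<And>j. j \<in> J \<Longrightarrow> y j = c + e j"
  shows "sample_range y J = sample_range e J"
proof -
  have "y ` J = (\<lambda>j. c + e j) ` J" using assms(3) by (rule image_cong[OF refl])
  then show ?thesis
    using assms by (simp add: sample_range_def Max_image_add_left Min_image_add_left)
qed

lemma sample_midrange_shift:
  assumes "finite J" "J \<noteq> {}" "\<And>j. j \<in> J \<Longrightarrow> y j = c + e j"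
  shows "sample_midrange y J = c + sample_midrange e J"
proof -
  have "y ` J = (\<lambda>j. c + e j) ` J" using assms(3) by (rule image_cong[OF refl])
  then show ?thesis
    using assms
    by (simp add: sample_midrange_def Max_image_add_left Min_image_add_left field_simps)
qed

text \<open>
  On block \<open>l\<close> the candidate \<open>\<tau>\<close> fits the single constant \<open>(V \<tau>)\<^sub>l\<close>, so each block separately forces
  half its range.
\<close>

lemma max_residual_ge_half_range:
  fixes V :: "real^'q^'q"
  assumes J: "(\<Union>l. J l) = {1..N}" "\<And>l. J l \<noteq> {}" "\<And>l j. j \<in> J l \<Longrightarrow> x j = V $ l"
  shows "1 / 2 * Max (range (\<lambda>l. sample_range y (J l))) \<le> max_residual N x y \<tau>"
proof -
  have sub: "J l \<subseteq> {1..N}" for l using J(1) by blast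
  have "sample_range y (J l) / 2 \<le> max_residual N x y \<tau>" for l
  proof (rule half_sample_range_le[where c = "(V *v \<tau>) $ l"])
    fix j assume j: "j \<in> J l"
    have "\<bar>y j - (\<Sum>i\<in>UNIV. \<tau> $ i * x j $ i)\<bar> \<le> max_residual N x y \<tau>"
      unfolding max_residual_def using j sub by (intro Max_ge) auto
    then show "\<bar>y j - (V *v \<tau>) $ l\<bar> \<le> max_residual N x y \<tau>"
      using J(3)[OF j] by (simp add: matrix_vector_mult_def mult.commute)
  qed (use J(2) finite_subset[OF sub] in auto)
  then have "sample_range y (J l) \<le> 2 * max_residual N x y \<tau>" for l
    by (smt (verit) field_sum_of_halves)
  then have "r \<le> 2 * max_residual N x y \<tau>" if "r \<in> range (\<lambda>l. sample_range y (J l))" for r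
    using that by blast
  then have "Max (range (\<lambda>l. sample_range y (J l))) \<le> 2 * max_residual N x y \<tau>"
    by (rule Max.boundedI[rotated 2]) simp_all
  then show ?thesis by linarith
qed

text \<open>
  The lower bound is attained when the constant fitted on every block is the centre of that block.
\<close>

lemma max_residual_midrange_fit:
  fixes V :: "real^'q^'q"
  assumes J: "(\<Union>l. J l) = {1..N}" "\<And>l. J l \<noteq> {}" "\<And>l j. j \<in> J l \<Longrightarrow> x j = V $ l"
    and fit: "\<And>l. (V *v \<tau>) $ l = sample_midrange y (J l)"
  shows "max_residual N x y \<tau> = 1 / 2 * Max (range (\<lambda>l. sample_range y (J l)))"
proof (rule antisym)
  have sub: "J l \<subseteq> {1..N}" for l using J(1) by blast
  have ne: "{1..N} \<noteq> {}" using J(2) sub by blast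
  show "max_residual N x y \<tau> \<le> 1 / 2 * Max (range (\<lambda>l. sample_range y (J l)))"
    unfolding max_residual_def
  proof (rule Max.boundedI)
    fix r assume "r \<in> (\<lambda>j. \<bar>y j - (\<Sum>i\<in>UNIV. \<tau> $ i * x j $ i)\<bar>) ` {1..N}"
    then obtain j where j: "j \<in> {1..N}" and r: "r = \<bar>y j - (\<Sum>i\<in>UNIV. \<tau> $ i * x j $ i)\<bar>" by blast
    obtain l where l: "j \<in> J l" using j J(1) by blast
    have "r = \<bar>y j - sample_midrange y (J l)\<bar>"
      using J(3)[OF l] by (simp add: r fit[symmetric] matrix_vector_mult_def mult.commute)
    also have "\<dots> \<le> sample_range y (J l) / 2"
      using l sub[of l] by (intro abs_diff_sample_midrange_le) (auto intro: finite_subset)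
    also have "\<dots> \<le> 1 / 2 * Max (range (\<lambda>l. sample_range y (J l)))"
      by simp
    finally show "r \<le> 1 / 2 * Max (range (\<lambda>l. sample_range y (J l)))" .
  qed (use ne in auto)
qed (rule max_residual_ge_half_range[OF J])

lemma cramer_replace_column:
  fixes V :: "real^'q^'q"
  assumes "det V \<noteq> 0"
  shows "V *v (\<chi> i. det (replace_column V i c) / det V) = (\<chi> l. c l)"
proof -
  have "replace_column V i c = (\<chi> l k. if k = i then (\<chi> l. c l) $ l else V $ l $ k)" for i
    by (simp add: replace_column_def vec_eq_iff)
  then show ?thesis
    using cramer[OF assms, of "\<chi> i. det (replace_column V i c) / det V" "\<chi> l. c l"] by simp
qed

text \<open>
  By Cramer's rule the quotients are the coordinates of \<open>V\<^sup>-\<^sup>1 c\<close>. Linearity in \<open>c\<close> is what measurability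
  of the estimator and the passage to characteristic functions rely on.
\<close>

lemma det_replace_column_linear:
  fixes V :: "real^'q^'q"
  assumes "det V \<noteq> 0"
  obtains B :: "real^'q^'q"
    where "B ** V = mat 1" and "\<And>i c. det (replace_column V i c) / det V = (\<Sum>l\<in>UNIV. B $ i $ l * c l)"
proof -
  obtain B where B: "B ** V = mat 1"
    using assms unfolding invertible_det_nz[symmetric] invertible_def by blast
  have "det (replace_column V i c) / det V = (\<Sum>l\<in>UNIV. B $ i $ l * c l)" for i c
  proof -
    have "B *v (V *v (\<chi> i. det (replace_column V i c) / det V)) = B *v (\<chi> l. c l)"
      by (simp only: cramer_replace_column[OF assms])
    then have "(\<chi> i. det (replace_column V i c) / det V) = B *v (\<chi> l. c l)"
      by (simp add: matrix_vector_mul_assoc B)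
    then have "(\<chi> i. det (replace_column V i c) / det V) $ i = (B *v (\<chi> l. c l)) $ i"
      by (simp only:)
    then show ?thesis by (simp add: matrix_vector_mult_def)
  qed
  then show ?thesis by (rule that[OF B])
qed

section \<open>Asymptotic independence and characteristic functions\<close>

text \<open>
  Normalising the weights \<open>W\<^sub>n\<close> turns them into densities of new probability measures. The hypotheses say
  that under these the distribution functions of \<open>X\<^sub>n\<close> converge, so the portmanteau theorem on the line
  applies to them. When the total weight tends to \<open>0\<close> there is nothing to normalise, but then both
  sides vanish.
\<close>

lemma (in prob_space) weighted_weak_conv:
  fixes X W :: "nat \<Rightarrow> 'a \<Rightarrow> real" and h :: "real \<Rightarrow> 'b :: {banach, second_countable_topology}"
  assumes \<mu>: "real_distribution \<mu>"
    and [measurable]: "\<And>n. random_variable borel (X n)" "\<And>n. random_variable borel (W n)"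
    and W: "\<And>n \<omega>. 0 \<le> W n \<omega>" "\<And>n \<omega>. W n \<omega> \<le> B"
    and c: "(\<lambda>n. expectation (W n)) \<longlonglongrightarrow> c"
    and conv: "\<And>u. isCont (cdf \<mu>) u \<Longrightarrow>
      (\<lambda>n. expectation (\<lambda>\<omega>. W n \<omega> * indicator {..u} (X n \<omega>))) \<longlonglongrightarrow> c * cdf \<mu> u"
    and h: "\<And>z. isCont h z" "\<And>z. norm (h z) \<le> C"
  shows "(\<lambda>n. expectation (\<lambda>\<omega>. W n \<omega> *\<^sub>R h (X n \<omega>))) \<longlonglongrightarrow> c *\<^sub>R (LINT z|\<mu>. h z)"
proof -
  have [measurable]: "h \<in> borel_measurable borel"
    using h(1) by (intro borel_measurable_continuous_onI continuous_at_imp_continuous_on) auto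
  have B0: "0 \<le> B" using W(1)[of 0 undefined] W(2)[of 0 undefined] by linarith
  have intW: "integrable M (W n)" for n
    by (rule integrable_const_bound[of _ B]) (simp_all add: W)
  have intWh: "integrable M (\<lambda>\<omega>. W n \<omega> *\<^sub>R h (X n \<omega>))" for n
    by (rule integrable_const_bound[of _ "B * C"]) (auto intro!: mult_mono simp: W h B0)
  define e where "e n = expectation (W n)" for n
  have e0: "0 \<le> e n" for n unfolding e_def by (rule integral_nonneg_AE) (simp add: W)
  have c0: "0 \<le> c" by (rule LIMSEQ_le_const[OF c]) (use e0 in \<open>simp add: e_def\<close>)
  show ?thesis
  proof (cases "c = 0")
    case True
    have bound: "norm (expectation (\<lambda>\<omega>. W n \<omega> *\<^sub>R h (X n \<omega>))) \<le> e n * C" for n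
    proof -
      have "norm (expectation (\<lambda>\<omega>. W n \<omega> *\<^sub>R h (X n \<omega>))) \<le> expectation (\<lambda>\<omega>. norm (W n \<omega> *\<^sub>R h (X n \<omega>)))"
        by (rule integral_norm_bound)
      also have "\<dots> \<le> expectation (\<lambda>\<omega>. W n \<omega> * C)"
      proof (rule integral_mono)
        show "integrable M (\<lambda>\<omega>. norm (W n \<omega> *\<^sub>R h (X n \<omega>)))" by (rule integrable_norm[OF intWh])
        show "integrable M (\<lambda>\<omega>. W n \<omega> * C)" by (rule integrable_mult_left[OF intW])
        show "norm (W n \<omega> *\<^sub>R h (X n \<omega>)) \<le> W n \<omega> * C" for \<omega>
          unfolding norm_scaleR abs_of_nonneg[OF W(1)] by (rule mult_left_mono[OF h(2) W(1)])
      qed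
      also have "expectation (\<lambda>\<omega>. W n \<omega> * C) = e n * C"
        unfolding e_def by (rule integral_mult_left_zero)
      finally show ?thesis .
    qed
    have "e \<longlonglongrightarrow> 0"
      using c True by (simp add: e_def[abs_def])
    then have "(\<lambda>n. e n * C) \<longlonglongrightarrow> 0"
      by (rule tendsto_mult_left_zero)
    then have "(\<lambda>n. expectation (\<lambda>\<omega>. W n \<omega> *\<^sub>R h (X n \<omega>))) \<longlonglongrightarrow> 0"
      by (rule Lim_null_comparison[OF always_eventually[OF allI[OF bound]]])
    then show ?thesis unfolding True scaleR_zero_left .
  next
    case False
    then have "0 < c" using c0 by simp
    then have ev: "eventually (\<lambda>n. 0 < e n) sequentially"
      using order_tendstoD(1)[OF c] by (simp add: e_def)
    \<comment> \<open>The total weight is only eventually positive; the default \<open>M\<close> keeps every \<open>D n\<close> a probability measure.\<close>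
    define D where "D n = (if 0 < e n then density M (\<lambda>\<omega>. ennreal (W n \<omega> / e n)) else M)" for n
    have sets_D[measurable_cong]: "sets (D n) = sets M" for n by (simp add: D_def)
    have prob_D: "prob_space (D n)" for n
    proof (cases "0 < e n")
      case True
      have "emeasure (D n) (space (D n)) = (\<integral>\<^sup>+ \<omega>. ennreal (W n \<omega> / e n) \<partial>M)"
      proof -
        have "emeasure (D n) (space (D n)) = (\<integral>\<^sup>+ \<omega>. ennreal (W n \<omega> / e n) * indicator (space M) \<omega> \<partial>M)"
          using True unfolding D_def by (simp add: emeasure_density)
        also have "\<dots> = (\<integral>\<^sup>+ \<omega>. ennreal (W n \<omega> / e n) \<partial>M)"
          by (rule nn_integral_cong) simp
        finally show ?thesis .
      qed
      also have "\<dots> = ennreal (expectation (\<lambda>\<omega>. W n \<omega> / e n))"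
        by (rule nn_integral_eq_integral) (simp_all add: intW W e0)
      also have "\<dots> = 1" using True by (simp add: e_def)
      finally show ?thesis by (rule prob_spaceI)
    qed (simp add: D_def prob_space_axioms)
    have D_int: "integral\<^sup>L (D n) f = expectation (\<lambda>\<omega>. (W n \<omega> / e n) *\<^sub>R f \<omega>)"
      if "0 < e n" "f \<in> borel_measurable M" for n and f :: "'a \<Rightarrow> 'c :: {banach, second_countable_topology}"
      using that W unfolding D_def by (simp add: integral_density)
    have rd: "real_distribution (distr (D n) borel (X n))" for n
      by (intro prob_space.real_distribution_distr prob_D) simp
    have "weak_conv_m (\<lambda>n. distr (D n) borel (X n)) \<mu>"
      unfolding weak_conv_m_def weak_conv_def
    proof (intro allI impI)
      fix u assume u: "isCont (cdf \<mu>) u"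
      have "cdf (distr (D n) borel (X n)) u = expectation (\<lambda>\<omega>. W n \<omega> * indicator {..u} (X n \<omega>)) / e n"
        if "0 < e n" for n
      proof -
        have "cdf (distr (D n) borel (X n)) u = (LINT z|distr (D n) borel (X n). indicator {..u} z)"
          by (simp add: cdf_def)
        also have "\<dots> = (LINT \<omega>|D n. indicator {..u} (X n \<omega>))"
          by (rule integral_distr) auto
        also have "\<dots> = expectation (\<lambda>\<omega>. (W n \<omega> / e n) *\<^sub>R indicator {..u} (X n \<omega>))"
          by (rule D_int[OF that]) auto
        finally show ?thesis by simp
      qed
      then have "eventually (\<lambda>n. expectation (\<lambda>\<omega>. W n \<omega> * indicator {..u} (X n \<omega>)) / e n
          = cdf (distr (D n) borel (X n)) u) sequentially"
        by (intro eventually_mono[OF ev]) simp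
      moreover have "(\<lambda>n. expectation (\<lambda>\<omega>. W n \<omega> * indicator {..u} (X n \<omega>)) / e n) \<longlonglongrightarrow> c * cdf \<mu> u / c"
        using False unfolding e_def by (intro tendsto_divide conv[OF u] c)
      ultimately show "(\<lambda>n. cdf (distr (D n) borel (X n)) u) \<longlonglongrightarrow> cdf \<mu> u"
        using False by (simp add: Lim_transform_eventually)
    qed
    then have "(\<lambda>n. LINT z|distr (D n) borel (X n). h z) \<longlonglongrightarrow> (LINT z|\<mu>. h z)"
      by (rule weak_conv_imp_integral_bdd_continuous_conv[OF rd \<mu> _ h])
    then have "(\<lambda>n. e n *\<^sub>R (LINT z|distr (D n) borel (X n). h z)) \<longlonglongrightarrow> c *\<^sub>R (LINT z|\<mu>. h z)"
      using c unfolding e_def by (intro tendsto_scaleR)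
    moreover have "e n *\<^sub>R (LINT z|distr (D n) borel (X n). h z) = expectation (\<lambda>\<omega>. W n \<omega> *\<^sub>R h (X n \<omega>))"
      if "0 < e n" for n
    proof -
      have "(LINT z|distr (D n) borel (X n). h z) = (LINT \<omega>|D n. h (X n \<omega>))"
        by (rule integral_distr) auto
      also have "\<dots> = expectation (\<lambda>\<omega>. (W n \<omega> / e n) *\<^sub>R h (X n \<omega>))"
        by (rule D_int[OF that]) auto
      also have "\<dots> = expectation (\<lambda>\<omega>. inverse (e n) *\<^sub>R W n \<omega> *\<^sub>R h (X n \<omega>))"
        by (simp add: field_simps)
      also have "\<dots> = inverse (e n) *\<^sub>R expectation (\<lambda>\<omega>. W n \<omega> *\<^sub>R h (X n \<omega>))"
        by (rule integral_scaleR_right)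
      finally show ?thesis using that by simp
    qed
    ultimately show ?thesis
      by (rule Lim_transform_eventually[OF _ eventually_mono[OF ev]])
  qed
qed

text \<open>
  Convergence of joint distribution functions is a statement about products of indicators. Weighting by
  the indicator of \<open>Y\<^sub>n \<le> w\<close> upgrades the factor depending on \<open>X\<^sub>n\<close> to a continuous function; weighting by
  that function then upgrades the factor depending on \<open>Y\<^sub>n\<close>. No weak convergence theory in the plane is
  involved.
\<close>

lemma (in prob_space) expectation_product_tendsto:
  fixes X Y :: "nat \<Rightarrow> 'a \<Rightarrow> real" and g :: "real \<Rightarrow> real"
    and h :: "real \<Rightarrow> 'b :: {banach, second_countable_topology}"
  assumes \<mu>: "real_distribution \<mu>" and \<nu>: "real_distribution \<nu>"
    and [measurable]: "\<And>n. random_variable borel (X n)" "\<And>n. random_variable borel (Y n)"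
    and X: "\<And>u. (\<lambda>n. prob {\<omega>\<in>space M. X n \<omega> \<le> u}) \<longlonglongrightarrow> cdf \<mu> u"
    and Y: "\<And>w. (\<lambda>n. prob {\<omega>\<in>space M. Y n \<omega> \<le> w}) \<longlonglongrightarrow> cdf \<nu> w"
    and XY: "\<And>u w. (\<lambda>n. prob {\<omega>\<in>space M. X n \<omega> \<le> u \<and> Y n \<omega> \<le> w}) \<longlonglongrightarrow> cdf \<mu> u * cdf \<nu> w"
    and g: "\<And>z. isCont g z" "\<And>z. \<bar>g z\<bar> \<le> B"
    and h: "\<And>z. isCont h z" "\<And>z. norm (h z) \<le> C"
  shows "(\<lambda>n. expectation (\<lambda>\<omega>. g (X n \<omega>) *\<^sub>R h (Y n \<omega>))) \<longlonglongrightarrow> (LINT z|\<mu>. g z) *\<^sub>R (LINT z|\<nu>. h z)"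
proof -
  interpret \<mu>: real_distribution \<mu> by fact
  have [measurable]: "g \<in> borel_measurable borel" "h \<in> borel_measurable borel"
    using g(1) h(1) by (auto intro!: borel_measurable_continuous_onI continuous_at_imp_continuous_on)
  \<comment> \<open>A weight has to be nonnegative; the shift by \<open>B\<close> is subtracted again at the end.\<close>
  define k where "k z = B + g z" for z
  have k: "isCont k z" "0 \<le> k z" "k z \<le> 2 * B" "norm (k z) \<le> 2 * B" "\<bar>k z\<bar> \<le> 2 * B" for z
    using g(2)[of z] g(1)[of z] unfolding k_def[abs_def]
    by (auto simp: abs_le_iff intro!: continuous_intros)
  have [measurable]: "k \<in> borel_measurable borel" unfolding k_def by measurable
  have B0: "0 \<le> B" using g(2)[of 0] by linarith
  have ind: "expectation (\<lambda>\<omega>. indicat_real {..w} (Z \<omega>)) = prob {\<omega>\<in>space M. Z \<omega> \<le> w}"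
    if [measurable]: "random_variable borel Z" for Z :: "'a \<Rightarrow> real" and w
  proof -
    have "expectation (\<lambda>\<omega>. indicat_real {..w} (Z \<omega>)) = expectation (indicator {\<omega>\<in>space M. Z \<omega> \<le> w})"
      by (intro Bochner_Integration.integral_cong) (auto simp: indicator_def)
    then show ?thesis by simp
  qed
  have ind2: "expectation (\<lambda>\<omega>. indicat_real {..w} (Y n \<omega>) * indicator {..u} (X n \<omega>)) =
      prob {\<omega>\<in>space M. X n \<omega> \<le> u \<and> Y n \<omega> \<le> w}" for w u n
  proof -
    have "expectation (\<lambda>\<omega>. indicat_real {..w} (Y n \<omega>) * indicator {..u} (X n \<omega>)) =
        expectation (indicator {\<omega>\<in>space M. X n \<omega> \<le> u \<and> Y n \<omega> \<le> w})"
      by (intro Bochner_Integration.integral_cong) (auto simp: indicator_def)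
    then show ?thesis by simp
  qed
  have step1: "(\<lambda>n. expectation (\<lambda>\<omega>. indicator {..w} (Y n \<omega>) *\<^sub>R k (X n \<omega>))) \<longlonglongrightarrow> cdf \<nu> w *\<^sub>R (LINT z|\<mu>. k z)" for w
  proof (rule weighted_weak_conv[OF \<mu>, where B = 1 and C = "2 * B"])
    show "(\<lambda>n. expectation (\<lambda>\<omega>. indicator {..w} (Y n \<omega>))) \<longlonglongrightarrow> cdf \<nu> w"
      using Y by (simp add: ind)
    show "(\<lambda>n. expectation (\<lambda>\<omega>. indicator {..w} (Y n \<omega>) * indicator {..u} (X n \<omega>))) \<longlonglongrightarrow> cdf \<nu> w * cdf \<mu> u" for u
      using XY[of u w] by (simp only: ind2 mult.commute[of "cdf \<nu> w"])
  qed (auto intro!: k simp: indicator_def)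
  have step0: "(\<lambda>n. expectation (\<lambda>\<omega>. 1 *\<^sub>R f (Z n \<omega>))) \<longlonglongrightarrow> 1 *\<^sub>R (LINT z|\<kappa>. f z)"
    if "real_distribution \<kappa>" "\<And>n. random_variable borel (Z n)"
      "\<And>u. (\<lambda>n. prob {\<omega>\<in>space M. Z n \<omega> \<le> u}) \<longlonglongrightarrow> cdf \<kappa> u" "\<And>z. isCont f z" "\<And>z. norm (f z) \<le> b"
    for \<kappa> and Z :: "nat \<Rightarrow> 'a \<Rightarrow> real" and f :: "real \<Rightarrow> 'c :: {banach, second_countable_topology}" and b
  proof (rule weighted_weak_conv[OF that(1,2), where B = 1 and C = b])
    show "(\<lambda>n. expectation (\<lambda>\<omega>. 1 :: real)) \<longlonglongrightarrow> 1" by (simp add: prob_space)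
    show "(\<lambda>n. expectation (\<lambda>\<omega>. 1 * indicator {..u} (Z n \<omega>))) \<longlonglongrightarrow> 1 * cdf \<kappa> u" for u
      using that(3)[of u] by (simp add: ind[OF that(2)])
  qed (simp_all add: that(4,5))
  have step2: "(\<lambda>n. expectation (\<lambda>\<omega>. k (X n \<omega>) *\<^sub>R h (Y n \<omega>))) \<longlonglongrightarrow> (LINT z|\<mu>. k z) *\<^sub>R (LINT z|\<nu>. h z)"
  proof (rule weighted_weak_conv[OF \<nu>, where B = "2 * B"])
    show "(\<lambda>n. expectation (\<lambda>\<omega>. k (X n \<omega>))) \<longlonglongrightarrow> (LINT z|\<mu>. k z)"
      using step0[OF \<mu> _ X k(1) k(4)] by simp
    show "(\<lambda>n. expectation (\<lambda>\<omega>. k (X n \<omega>) * indicator {..u} (Y n \<omega>))) \<longlonglongrightarrow> (LINT z|\<mu>. k z) * cdf \<nu> u" for u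
      using step1[of u] by (simp add: mult.commute)
  qed (auto intro!: k h)
  have "(\<lambda>n. expectation (\<lambda>\<omega>. k (X n \<omega>) *\<^sub>R h (Y n \<omega>)) - B *\<^sub>R expectation (\<lambda>\<omega>. h (Y n \<omega>)))
      \<longlonglongrightarrow> (LINT z|\<mu>. k z) *\<^sub>R (LINT z|\<nu>. h z) - B *\<^sub>R (LINT z|\<nu>. h z)"
    using step0[OF \<nu> _ Y h] by (intro tendsto_diff step2 tendsto_scaleR tendsto_const) simp
  moreover have "expectation (\<lambda>\<omega>. k (X n \<omega>) *\<^sub>R h (Y n \<omega>)) - B *\<^sub>R expectation (\<lambda>\<omega>. h (Y n \<omega>))
      = expectation (\<lambda>\<omega>. g (X n \<omega>) *\<^sub>R h (Y n \<omega>))" for n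
  proof -
    have 1: "integrable M (\<lambda>\<omega>. h (Y n \<omega>))"
      by (rule integrable_const_bound[of _ C]) (use h in auto)
    have 2: "integrable M (\<lambda>\<omega>. g (X n \<omega>) *\<^sub>R h (Y n \<omega>))"
      by (rule integrable_const_bound[of _ "B * C"]) (use g h B0 in \<open>auto intro!: mult_mono\<close>)
    have "expectation (\<lambda>\<omega>. k (X n \<omega>) *\<^sub>R h (Y n \<omega>))
        = expectation (\<lambda>\<omega>. B *\<^sub>R h (Y n \<omega>) + g (X n \<omega>) *\<^sub>R h (Y n \<omega>))"
      by (simp add: k_def scaleR_add_left)
    also have "\<dots> = B *\<^sub>R expectation (\<lambda>\<omega>. h (Y n \<omega>)) + expectation (\<lambda>\<omega>. g (X n \<omega>) *\<^sub>R h (Y n \<omega>))"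
      using 1 2 by simp
    finally show ?thesis by simp
  qed
  moreover have "(LINT z|\<mu>. k z) = B + (LINT z|\<mu>. g z)"
  proof -
    have "integrable \<mu> g" by (rule \<mu>.integrable_const_bound[of _ B]) (use g in auto)
    then show ?thesis using \<mu>.prob_space by (simp add: k_def)
  qed
  ultimately show ?thesis by (simp add: scaleR_add_left)
qed

text \<open>
  Reweighting needs real factors, hence the split of \<open>exp (i t a X)\<close> into cosine and sine.
\<close>

lemma (in prob_space) char_sum_tendsto:
  fixes X Y :: "nat \<Rightarrow> 'a \<Rightarrow> real"
  assumes \<mu>: "real_distribution \<mu>" and \<nu>: "real_distribution \<nu>"
    and meas[measurable]: "\<And>n. random_variable borel (X n)" "\<And>n. random_variable borel (Y n)"
    and X: "\<And>u. (\<lambda>n. prob {\<omega>\<in>space M. X n \<omega> \<le> u}) \<longlonglongrightarrow> cdf \<mu> u"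
    and Y: "\<And>w. (\<lambda>n. prob {\<omega>\<in>space M. Y n \<omega> \<le> w}) \<longlonglongrightarrow> cdf \<nu> w"
    and XY: "\<And>u w. (\<lambda>n. prob {\<omega>\<in>space M. X n \<omega> \<le> u \<and> Y n \<omega> \<le> w}) \<longlonglongrightarrow> cdf \<mu> u * cdf \<nu> w"
  shows "(\<lambda>n. char (distr M borel (\<lambda>\<omega>. a * X n \<omega> + b * Y n \<omega>)) t) \<longlonglongrightarrow> char \<mu> (t * a) * char \<nu> (t * b)"
proof -
  interpret \<mu>: real_distribution \<mu> by fact
  define h where "h z = iexp ((t * b) * z)" for z
  have h: "isCont h z" "norm (h z) \<le> 1" for z
    unfolding h_def[abs_def] by (auto intro!: continuous_intros)
  have [measurable]: "h \<in> borel_measurable borel" unfolding h_def[abs_def] by simp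
  have c: "(\<lambda>n. expectation (\<lambda>\<omega>. cos (t * a * X n \<omega>) *\<^sub>R h (Y n \<omega>))) \<longlonglongrightarrow> (LINT z|\<mu>. cos (t * a * z)) *\<^sub>R (LINT z|\<nu>. h z)"
    by (rule expectation_product_tendsto[OF \<mu> \<nu> meas X Y XY _ _ h, where B = 1 and g = "\<lambda>z. cos (t * a * z)"])
       (auto intro!: continuous_intros)
  have s: "(\<lambda>n. expectation (\<lambda>\<omega>. sin (t * a * X n \<omega>) *\<^sub>R h (Y n \<omega>))) \<longlonglongrightarrow> (LINT z|\<mu>. sin (t * a * z)) *\<^sub>R (LINT z|\<nu>. h z)"
    by (rule expectation_product_tendsto[OF \<mu> \<nu> meas X Y XY _ _ h, where B = 1 and g = "\<lambda>z. sin (t * a * z)"])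
       (auto intro!: continuous_intros)
  have char: "char (distr M borel (\<lambda>\<omega>. a * X n \<omega> + b * Y n \<omega>)) t =
      expectation (\<lambda>\<omega>. cos (t * a * X n \<omega>) *\<^sub>R h (Y n \<omega>)) + \<i> * expectation (\<lambda>\<omega>. sin (t * a * X n \<omega>) *\<^sub>R h (Y n \<omega>))" for n
  proof -
    have 1: "integrable M (\<lambda>\<omega>. cos (t * a * X n \<omega>) *\<^sub>R h (Y n \<omega>))"
       by (rule integrable_const_bound[of _ 1]) (use h in \<open>auto intro!: mult_le_one\<close>)
    have 2: "integrable M (\<lambda>\<omega>. sin (t * a * X n \<omega>) *\<^sub>R h (Y n \<omega>))"
       by (rule integrable_const_bound[of _ 1]) (use h in \<open>auto intro!: mult_le_one\<close>)
    have "char (distr M borel (\<lambda>\<omega>. a * X n \<omega> + b * Y n \<omega>)) t = expectation (\<lambda>\<omega>. iexp (t * (a * X n \<omega> + b * Y n \<omega>)))"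
      unfolding char_def by (rule integral_distr) auto
    also have "\<dots> = expectation (\<lambda>\<omega>. cos (t * a * X n \<omega>) *\<^sub>R h (Y n \<omega>) + \<i> * (sin (t * a * X n \<omega>) *\<^sub>R h (Y n \<omega>)))"
    proof (intro Bochner_Integration.integral_cong refl)
      fix \<omega>
      have "iexp (t * (a * X n \<omega> + b * Y n \<omega>)) = iexp (t * a * X n \<omega>) * h (Y n \<omega>)"
        by (simp add: h_def exp_add[symmetric] algebra_simps)
      then show "iexp (t * (a * X n \<omega> + b * Y n \<omega>)) = cos (t * a * X n \<omega>) *\<^sub>R h (Y n \<omega>) + \<i> * (sin (t * a * X n \<omega>) *\<^sub>R h (Y n \<omega>))"
        by (simp add: exp_Euler cos_of_real sin_of_real scaleR_conv_of_real algebra_simps flip: of_real_mult)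
    qed
    also have "\<dots> = expectation (\<lambda>\<omega>. cos (t * a * X n \<omega>) *\<^sub>R h (Y n \<omega>)) + \<i> * expectation (\<lambda>\<omega>. sin (t * a * X n \<omega>) *\<^sub>R h (Y n \<omega>))"
      by (simp only: Bochner_Integration.integral_add[OF 1 integrable_mult_right[OF 2]] integral_mult_right_zero)
    finally show ?thesis .
  qed
  have "char \<mu> (t * a) = (LINT z|\<mu>. cos (t * a * z)) + \<i> * (LINT z|\<mu>. sin (t * a * z))"
  proof -
    have 1: "integrable \<mu> (\<lambda>z. complex_of_real (cos (t * a * z)))"
       by (rule \<mu>.integrable_const_bound[of _ 1]) auto
    have 2: "integrable \<mu> (\<lambda>z. complex_of_real (sin (t * a * z)))"
       by (rule \<mu>.integrable_const_bound[of _ 1]) auto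
    have "char \<mu> (t * a) = (LINT z|\<mu>. complex_of_real (cos (t * a * z)) + \<i> * complex_of_real (sin (t * a * z)))"
      unfolding char_def
      by (intro Bochner_Integration.integral_cong refl)
         (simp add: exp_Euler cos_of_real sin_of_real flip: of_real_mult)
    also have "\<dots> = (LINT z|\<mu>. complex_of_real (cos (t * a * z))) + \<i> * (LINT z|\<mu>. complex_of_real (sin (t * a * z)))"
      using 1 2 by simp
    finally show ?thesis by simp
  qed
  then have "char \<mu> (t * a) * char \<nu> (t * b) =
      (LINT z|\<mu>. cos (t * a * z)) *\<^sub>R (LINT z|\<nu>. h z) + \<i> * ((LINT z|\<mu>. sin (t * a * z)) *\<^sub>R (LINT z|\<nu>. h z))"
    by (simp add: char_def h_def scaleR_conv_of_real algebra_simps)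
  then show ?thesis
    unfolding char by (simp only:) (intro tendsto_add tendsto_mult_left c s)
qed

section \<open>Extremes of a block of symmetric variables\<close>

text \<open>
  If \<open>f\<^sup>m\<close> stays away from \<open>0\<close> then \<open>1 - f\<close> is of order \<open>1/m\<close>, by \<open>ln f \<le> f - 1\<close>.
\<close>

lemma mult_one_minus_le_of_power_ge:
  fixes f :: real
  assumes "0 < c" "c \<le> f ^ m" "0 \<le> f" "0 < m"
  shows "real m * (1 - f) \<le> - ln c"
proof -
  have f: "0 < f" using assms by (cases "f = 0") (auto simp: power_0_left)
  have "ln c \<le> ln (f ^ m)" using assms f by simp
  also have "\<dots> = real m * ln f" using f by (simp add: ln_realpow)
  also have "\<dots> \<le> real m * (f - 1)" using ln_le_minus_one[OF f] by (intro mult_left_mono) auto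
  finally show ?thesis by (simp add: algebra_simps)
qed

text \<open>
  This is the asymptotic independence of maximum and minimum. Because
  \<open>f g - (f + g - 1) = (1 - f) (1 - g) \<ge> 0\<close>, the powers are dominated by those of \<open>f g\<close>, which settles the
  case of a zero limit. Otherwise \<open>1 - f\<close> and \<open>1 - g\<close> are of order \<open>1/n\<close>, and the two powers differ by at
  most \<open>(n + 1) (1 - f) (1 - g)\<close>, which is again of order \<open>1/n\<close>.
\<close>

lemma power_add_minus_one_tendsto:
  fixes f g :: "nat \<Rightarrow> real"
  assumes f: "\<And>n. 0 \<le> f n" "\<And>n. f n \<le> 1" and g: "\<And>n. 0 \<le> g n" "\<And>n. g n \<le> 1"
    and A: "(\<lambda>n. f n ^ Suc n) \<longlonglongrightarrow> A" and B: "(\<lambda>n. g n ^ Suc n) \<longlonglongrightarrow> B"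
  shows "(\<lambda>n. max 0 (f n + g n - 1) ^ Suc n) \<longlonglongrightarrow> A * B"
proof -
  have d: "0 \<le> (1 - f n) * (1 - g n)" for n using f[of n] g[of n] by simp
  have le: "max 0 (f n + g n - 1) \<le> f n * g n" for n
    using d[of n] f[of n] g[of n] by (auto simp: algebra_simps)
  have fg: "(\<lambda>n. (f n * g n) ^ Suc n) \<longlonglongrightarrow> A * B"
    using tendsto_mult[OF A B] by (simp only: power_mult_distrib)
  have A0: "0 \<le> A" "0 \<le> B"
    by (rule LIMSEQ_le_const[OF A], simp add: f) (rule LIMSEQ_le_const[OF B], simp add: g)
  show ?thesis
  proof (cases "A * B = 0")
    case True
    show ?thesis unfolding True
    proof (rule tendsto_sandwich[OF _ _ tendsto_const])
      show "\<forall>\<^sub>F n in sequentially. max 0 (f n + g n - 1) ^ Suc n \<le> (f n * g n) ^ Suc n"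
        using le by (intro always_eventually allI power_mono) auto
      show "(\<lambda>n. (f n * g n) ^ Suc n) \<longlonglongrightarrow> 0" using fg True by simp
    qed auto
  next
    case False
    then have pos: "0 < A / 2" "A / 2 < A" "0 < B / 2" "B / 2 < B" using A0 by auto
    have small: "\<forall>\<^sub>F n in sequentially. real (Suc n) * ((1 - f n) * (1 - g n))
        \<le> (- ln (A / 2)) * (- ln (B / 2)) / real (Suc n)"
      using order_tendstoD(1)[OF A pos(2)] order_tendstoD(1)[OF B pos(4)]
    proof eventually_elim
      case (elim n)
      have "real (Suc n) * (1 - f n) * (real (Suc n) * (1 - g n)) \<le> (- ln (A / 2)) * (- ln (B / 2))"
      proof (rule mult_mono)
        show 1: "real (Suc n) * (1 - f n) \<le> - ln (A / 2)"
          using elim f pos by (intro mult_one_minus_le_of_power_ge) auto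
        show "real (Suc n) * (1 - g n) \<le> - ln (B / 2)"
          using elim g pos by (intro mult_one_minus_le_of_power_ge) auto
        have "0 \<le> real (Suc n) * (1 - f n)" using f[of n] by simp
        then show "0 \<le> - ln (A / 2)" using 1 by (rule order_trans)
        show "0 \<le> real (Suc n) * (1 - g n)" using g[of n] by simp
      qed
      then have "real (Suc n) * ((1 - f n) * (1 - g n)) * real (Suc n) \<le> (- ln (A / 2)) * (- ln (B / 2))"
        by (simp only: ac_simps)
      then show ?case by (simp only: pos_le_divide_eq of_nat_0_less_iff zero_less_Suc)
    qed
    moreover have "(\<lambda>n. (- ln (A / 2)) * (- ln (B / 2)) / real (Suc n)) \<longlonglongrightarrow> 0"
      by (rule LIMSEQ_Suc[OF lim_const_over_n])
    moreover have diff: "norm (max 0 (f n + g n - 1) ^ Suc n - (f n * g n) ^ Suc n)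
        \<le> real (Suc n) * ((1 - f n) * (1 - g n))" for n
    proof -
      have fg1: "f n * g n \<le> 1" "0 \<le> f n * g n" using f[of n] g[of n] by (auto intro: mult_le_one)
      have "norm (max 0 (f n + g n - 1) ^ Suc n - (f n * g n) ^ Suc n)
          \<le> real (Suc n) * norm (max 0 (f n + g n - 1) - f n * g n)"
        using le[of n] fg1 by (intro norm_power_diff) auto
      also have "norm (max 0 (f n + g n - 1) - f n * g n) \<le> (1 - f n) * (1 - g n)"
        using le[of n] fg1 by (auto simp: algebra_simps)
      finally show ?thesis by (simp add: mult_left_mono)
    qed
    ultimately have "(\<lambda>n. max 0 (f n + g n - 1) ^ Suc n - (f n * g n) ^ Suc n) \<longlonglongrightarrow> 0"
      by (intro Lim_null_comparison[OF eventually_mono[OF small order_trans[OF diff]]])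
    from tendsto_add[OF this fg] show ?thesis by simp
  qed
qed

text \<open>
  By symmetry the mass left of \<open>- w\<close> is \<open>1 - F(w)\<close>. The maximum covers the case of an empty interval, in
  which the two tails overlap.
\<close>

lemma (in real_distribution) symmetric_measure_Icc:
  assumes sym: "M = distr M borel uminus"
  shows "measure M {- w..u} = max 0 (cdf M u + cdf M w - 1)"
proof -
  have "measure M {..<- w} = measure (distr M borel uminus) {..<- w}"
    using sym by simp
  also have "\<dots> = measure M {w<..}"
    by (subst measure_distr) (auto intro!: arg_cong[where f = "measure M"])
  also have "{w<..} = space M - {..w}" by auto
  also have "measure M (space M - {..w}) = 1 - cdf M w"
    unfolding cdf_def by (rule prob_compl) simp
  finally have left: "measure M {..<- w} = 1 - cdf M w" .
  show ?thesis
  proof (cases "- w \<le> u")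
    case True
    have "{- w..u} = {..u} - {..<- w}" by auto
    moreover have "measure M ({..u} - {..<- w}) = measure M {..u} - measure M {..<- w}"
      using True by (intro finite_measure_Diff) auto
    ultimately have "measure M {- w..u} = cdf M u + cdf M w - 1" by (simp add: left cdf_def2)
    then show ?thesis using measure_nonneg[of M "{- w..u}"] by simp
  next
    case False
    have "measure M {..u} \<le> measure M {..<- w}"
      using False by (intro finite_measure_mono) auto
    then show ?thesis using False left by (simp add: cdf_def2)
  qed
qed

lemma (in prob_space) prob_block_all_in:
  assumes indep: "indep_vars (\<lambda>_. borel) \<epsilon> I" and J: "finite J" "J \<noteq> {}" "J \<subseteq> I" and S: "S \<in> sets borel"
    and p: "\<And>j. j \<in> J \<Longrightarrow> measure (distr M borel (\<epsilon> j)) S = p"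
  shows "prob {\<omega>\<in>space M. \<forall>j\<in>J. \<epsilon> j \<omega> \<in> S} = p ^ card J"
proof -
  have rv: "random_variable borel (\<epsilon> j)" if "j \<in> J" for j
    using indep J that by (auto simp: indep_vars_def)
  have "prob (\<Inter>j\<in>J. \<epsilon> j -` S \<inter> space M) = (\<Prod>j\<in>J. prob (\<epsilon> j -` S \<inter> space M))"
    by (rule indep_varsD[OF indep]) (use J S in auto)
  also have "\<dots> = (\<Prod>j\<in>J. p)"
    using p rv S by (intro prod.cong) (auto simp: measure_distr)
  also have "(\<Inter>j\<in>J. \<epsilon> j -` S \<inter> space M) = {\<omega>\<in>space M. \<forall>j\<in>J. \<epsilon> j \<omega> \<in> S}"
    using J by auto
  finally show ?thesis by simp
qed

text \<open>
  Bounds on the scaled extremes confine every error of the block to one and the same interval; after the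
  sign change in \<open>Y\<close> both extremes are rescaled by the same constants.
\<close>

lemma (in prob_space) prob_block_extremes:
  fixes \<epsilon> :: "'i \<Rightarrow> 'a \<Rightarrow> real" and a b u w :: real
  assumes indep: "indep_vars (\<lambda>_. borel) \<epsilon> I" and J: "finite J" "J \<noteq> {}" "J \<subseteq> I"
    and F: "\<And>j. j \<in> I \<Longrightarrow> cdf (distr M borel (\<epsilon> j)) = F"
    and sym: "\<And>j. j \<in> I \<Longrightarrow> distr M borel (\<epsilon> j) = distr M borel (\<lambda>\<omega>. - \<epsilon> j \<omega>)"
    and b: "0 < b"
  defines "X \<equiv> \<lambda>\<omega>. b * (Max ((\<lambda>j. \<epsilon> j \<omega>) ` J) - a)" and "Y \<equiv> \<lambda>\<omega>. b * (- Min ((\<lambda>j. \<epsilon> j \<omega>) ` J) - a)"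
  shows "prob {\<omega>\<in>space M. X \<omega> \<le> u} = F (a + u / b) ^ card J"
    and "prob {\<omega>\<in>space M. Y \<omega> \<le> w} = F (a + w / b) ^ card J"
    and "prob {\<omega>\<in>space M. X \<omega> \<le> u \<and> Y \<omega> \<le> w} = max 0 (F (a + u / b) + F (a + w / b) - 1) ^ card J"
proof -
  have rv: "random_variable borel (\<epsilon> j)" if "j \<in> I" for j
    using indep that by (auto simp: indep_vars_def)
  have rd: "real_distribution (distr M borel (\<epsilon> j))" if "j \<in> I" for j
    using rv[OF that] by simp
  have sym': "distr M borel (\<epsilon> j) = distr (distr M borel (\<epsilon> j)) borel uminus" if "j \<in> I" for j
    using sym[OF that] rv[OF that] by (subst distr_distr) (auto simp: comp_def)
  have Icc: "measure (distr M borel (\<epsilon> j)) {- s..r} = max 0 (F r + F s - 1)" if "j \<in> I" for j r s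
    using real_distribution.symmetric_measure_Icc[OF rd[OF that] sym'[OF that]] by (simp add: F[OF that])
  have Iic: "measure (distr M borel (\<epsilon> j)) {..r} = F r" if "j \<in> I" for j r
    using F[OF that] by (auto simp: cdf_def)
  have Ici: "measure (distr M borel (\<epsilon> j)) {- s..} = F s" if "j \<in> I" for j s
  proof -
    have "measure (distr M borel (\<epsilon> j)) {- s..} = measure (distr (distr M borel (\<epsilon> j)) borel uminus) {- s..}"
      using sym'[OF that] by simp
    also have "\<dots> = measure (distr M borel (\<epsilon> j)) {..s}"
      by (subst measure_distr) (auto intro!: arg_cong[where f = "measure _"])
    finally show ?thesis by (simp add: Iic[OF that])
  qed
  have resc: "b * (m - a) \<le> v \<longleftrightarrow> m \<le> a + v / b" for m v
    using b by (simp add: field_simps)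
  have X: "X \<omega> \<le> u \<longleftrightarrow> (\<forall>j\<in>J. \<epsilon> j \<omega> \<in> {..a + u / b})" for \<omega> u
  proof -
    have "X \<omega> \<le> u \<longleftrightarrow> Max ((\<lambda>j. \<epsilon> j \<omega>) ` J) \<le> a + u / b"
      unfolding X_def by (rule resc)
    then show ?thesis using J by simp
  qed
  have Y: "Y \<omega> \<le> w \<longleftrightarrow> (\<forall>j\<in>J. \<epsilon> j \<omega> \<in> {- (a + w / b)..})" for \<omega> w
  proof -
    have "Y \<omega> \<le> w \<longleftrightarrow> - (a + w / b) \<le> Min ((\<lambda>j. \<epsilon> j \<omega>) ` J)"
      unfolding Y_def resc by (rule minus_le_iff)
    then show ?thesis using J by simp
  qed
  show "prob {\<omega>\<in>space M. X \<omega> \<le> u} = F (a + u / b) ^ card J"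
    unfolding X by (rule prob_block_all_in[OF indep J _ Iic]) (use J in auto)
  show "prob {\<omega>\<in>space M. Y \<omega> \<le> w} = F (a + w / b) ^ card J"
    unfolding Y by (rule prob_block_all_in[OF indep J _ Ici]) (use J in auto)
  have "{\<omega>\<in>space M. X \<omega> \<le> u \<and> Y \<omega> \<le> w} = {\<omega>\<in>space M. \<forall>j\<in>J. \<epsilon> j \<omega> \<in> {- (a + w / b)..a + u / b}}"
    unfolding X Y by auto
  also have "prob \<dots> = max 0 (F (a + u / b) + F (a + w / b) - 1) ^ card J"
    by (rule prob_block_all_in[OF indep J _ Icc]) (use J in auto)
  finally show "prob {\<omega>\<in>space M. X \<omega> \<le> u \<and> Y \<omega> \<le> w} = max 0 (F (a + u / b) + F (a + w / b) - 1) ^ card J" .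
qed

text \<open>
  The \<open>n\<close>th block has \<open>n + 1\<close> elements, so that no block is empty. The blocks for different \<open>n\<close> are
  unrelated, since the joint law of the extremes depends on the size of the block only.
\<close>

lemma (in prob_space) char_block_extremes_tendsto:
  fixes \<epsilon> :: "nat \<Rightarrow> 'a \<Rightarrow> real"
  assumes indep: "indep_vars (\<lambda>_. borel) \<epsilon> I" and J: "\<And>n. finite (J n)" "\<And>n. J n \<subseteq> I" "\<And>n. card (J n) = Suc n"
    and F: "\<And>j. j \<in> I \<Longrightarrow> cdf (distr M borel (\<epsilon> j)) = F"
    and sym: "\<And>j. j \<in> I \<Longrightarrow> distr M borel (\<epsilon> j) = distr M borel (\<lambda>\<omega>. - \<epsilon> j \<omega>)"
    and b: "\<And>n. 0 < b n" and \<mu>: "real_distribution \<mu>"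
    and lim: "\<And>u. (\<lambda>n. F (a n + u / b n) ^ Suc n) \<longlonglongrightarrow> cdf \<mu> u"
  shows "(\<lambda>n. char (distr M borel (\<lambda>\<omega>. p * (b n * (Max ((\<lambda>j. \<epsilon> j \<omega>) ` J n) - a n))
      + q * (b n * (- Min ((\<lambda>j. \<epsilon> j \<omega>) ` J n) - a n)))) t) \<longlonglongrightarrow> char \<mu> (t * p) * char \<mu> (t * q)"
proof (rule char_sum_tendsto[OF \<mu> \<mu>])
  have rv: "random_variable borel (\<epsilon> j)" if "j \<in> I" for j
    using indep that by (auto simp: indep_vars_def)
  have ne: "J n \<noteq> {}" for n using J(3)[of n] by auto
  have F01: "0 \<le> F z" "F z \<le> 1" for z
  proof -
    obtain j where "j \<in> I" using ne[of 0] J(2)[of 0] by blast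
    then interpret D: real_distribution "distr M borel (\<epsilon> j)" using rv by simp
    show "0 \<le> F z" "F z \<le> 1"
      using D.cdf_nonneg[of z] D.cdf_bounded_prob[of z] F[OF \<open>j \<in> I\<close>] by simp_all
  qed
  note block = prob_block_extremes[OF indep J(1) ne J(2) F sym b]
  show "random_variable borel (\<lambda>\<omega>. b n * (Max ((\<lambda>j. \<epsilon> j \<omega>) ` J n) - a n))" for n
    using J by (intro borel_measurable_times borel_measurable_diff borel_measurable_Max) (auto intro!: rv)
  show "random_variable borel (\<lambda>\<omega>. b n * (- Min ((\<lambda>j. \<epsilon> j \<omega>) ` J n) - a n))" for n
    using J by (intro borel_measurable_times borel_measurable_diff borel_measurable_uminus borel_measurable_Min)
      (auto intro!: rv)
  show "(\<lambda>n. prob {\<omega>\<in>space M. b n * (Max ((\<lambda>j. \<epsilon> j \<omega>) ` J n) - a n) \<le> u}) \<longlonglongrightarrow> cdf \<mu> u" for u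
    using lim[of u] by (simp only: block J(3))
  show "(\<lambda>n. prob {\<omega>\<in>space M. b n * (- Min ((\<lambda>j. \<epsilon> j \<omega>) ` J n) - a n) \<le> w}) \<longlonglongrightarrow> cdf \<mu> w" for w
    using lim[of w] by (simp only: block J(3))
  show "(\<lambda>n. prob {\<omega>\<in>space M. b n * (Max ((\<lambda>j. \<epsilon> j \<omega>) ` J n) - a n) \<le> u \<and>
      b n * (- Min ((\<lambda>j. \<epsilon> j \<omega>) ` J n) - a n) \<le> w}) \<longlonglongrightarrow> cdf \<mu> u * cdf \<mu> w" for u w
    using power_add_minus_one_tendsto[OF F01 F01 lim[of u] lim[of w]] by (simp only: block J(3))
qed

section \<open>Independent blocks\<close>

text \<open>
  A statistic of a block is here a function of the whole family that reads only the indices of its block,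
  as the maximum and minimum over an index set do.
\<close>

lemma (in prob_space) indep_vars_of_disjoint_blocks:
  assumes indep: "indep_vars (\<lambda>_. N) \<epsilon> I" and J: "disjoint_family J" "\<And>l. J l \<subseteq> I"
    and f: "\<And>l. f l \<in> measurable (Pi\<^sub>M (J l) (\<lambda>_. N)) L"
    and local: "\<And>l z. f l (restrict z (J l)) = f l z"
  shows "indep_vars (\<lambda>_. L) (\<lambda>l \<omega>. f l (\<lambda>j. \<epsilon> j \<omega>)) UNIV"
proof -
  have "indep_vars (\<lambda>l. Pi\<^sub>M (J l) (\<lambda>_. N)) (\<lambda>l \<omega>. restrict (\<lambda>j. \<epsilon> j \<omega>) (J l)) UNIV"
    by (rule indep_vars_restrict[OF indep]) (use J in auto)
  then have "indep_vars (\<lambda>_. L) (\<lambda>l \<omega>. f l (restrict (\<lambda>j. \<epsilon> j \<omega>) (J l))) UNIV"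
    by (rule indep_vars_compose2) (rule f)
  then show ?thesis by (simp only: local)
qed

section \<open>Extreme value distributions and convolution\<close>

text \<open>
  Only continuity at \<open>0\<close> needs an argument, for the Frechet and Weibull types: there the two branches of
  the definition meet, and the one-sided limits agree with the value.
\<close>

lemma extreme_value_df_regular:
  assumes "extreme_value_df G"
  shows "mono G" "isCont G x" "(G \<longlongrightarrow> 0) at_bot" "(G \<longlongrightarrow> 1) at_top"
proof -
  consider (frechet) \<alpha> where "\<alpha> > 0" "G = frechet_df \<alpha>" | (weibull) \<alpha> where "\<alpha> > 0" "G = weibull_df \<alpha>"
    | (gumbel) "G = gumbel_df"
    using assms unfolding extreme_value_df_def by blast
  then have "mono G \<and> isCont G x \<and> (G \<longlongrightarrow> 0) at_bot \<and> (G \<longlongrightarrow> 1) at_top"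
  proof cases
    case gumbel
    have "(gumbel_df \<longlongrightarrow> 0) at_bot" "(gumbel_df \<longlongrightarrow> 1) at_top"
      unfolding gumbel_df_def[abs_def] by real_asymp+
    moreover have "isCont gumbel_df x"
      unfolding gumbel_df_def[abs_def] by (intro continuous_intros)
    ultimately show ?thesis unfolding gumbel by (auto simp: mono_def gumbel_df_def)
  next
    case frechet
    note \<alpha> = frechet(1)
    have "mono G"
      unfolding frechet(2) mono_def frechet_df_def using \<alpha> by (auto intro!: powr_mono2')
    moreover have "isCont G x"
    proof -
      have 1: "continuous_on {0<..} G"
        by (rule continuous_on_eq[where f = "\<lambda>x. exp (- (x powr (- \<alpha>)))"])
           (auto simp: frechet frechet_df_def intro!: continuous_intros)
      have 2: "continuous_on {..<0} G"
        by (rule continuous_on_eq[where f = "\<lambda>x. 0"]) (auto simp: frechet frechet_df_def)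
      have 3: "((\<lambda>x. exp (- (x powr (- \<alpha>)))) \<longlongrightarrow> 0) (at_right 0)"
        using \<alpha> by real_asymp
      have "(G \<longlongrightarrow> 0) (at_right 0)"
        by (rule Lim_transform_eventually[OF 3])
           (auto simp: frechet frechet_df_def eventually_at_filter)
      moreover have "(G \<longlongrightarrow> 0) (at_left 0)"
        by (rule Lim_transform_eventually[OF tendsto_const])
           (auto simp: frechet frechet_df_def eventually_at_filter)
      moreover have "G 0 = 0" by (simp add: frechet frechet_df_def)
      ultimately have 4: "isCont G 0" by (simp add: isCont_def filterlim_split_at_real)
      show ?thesis
        using 1 2 4 continuous_on_eq_continuous_at[of "{0<..}" G] continuous_on_eq_continuous_at[of "{..<0}" G]
        by (cases x "0::real" rule: linorder_cases) auto
    qed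
    moreover have "(G \<longlongrightarrow> 0) at_bot"
      by (rule Lim_transform_eventually[OF tendsto_const])
         (auto simp: frechet frechet_df_def eventually_at_bot_linorder intro!: exI[of _ 0])
    moreover have "((\<lambda>x. exp (- (x powr (- \<alpha>)))) \<longlongrightarrow> 1) at_top"
      using \<alpha> by real_asymp
    then have "(G \<longlongrightarrow> 1) at_top"
      by (rule Lim_transform_eventually)
         (auto simp: frechet frechet_df_def eventually_at_top_dense intro!: exI[of _ 0])
    ultimately show ?thesis by blast
  next
    case weibull
    note \<alpha> = weibull(1)
    have "mono G"
      unfolding weibull(2) mono_def weibull_df_def using \<alpha> by (auto intro!: powr_mono2)
    moreover have "isCont G x"
    proof -
      have 1: "continuous_on {0<..} G"
        by (rule continuous_on_eq[where f = "\<lambda>x. 1"]) (auto simp: weibull weibull_df_def)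
      have 2: "continuous_on {..<0} G"
        by (rule continuous_on_eq[where f = "\<lambda>x. exp (- ((- x) powr \<alpha>))"])
           (auto simp: weibull weibull_df_def intro!: continuous_intros)
      have 3: "((\<lambda>x. exp (- ((- x) powr \<alpha>))) \<longlongrightarrow> 1) (at_left 0)"
        using \<alpha> by real_asymp
      have "(G \<longlongrightarrow> 1) (at_left 0)"
        by (rule Lim_transform_eventually[OF 3])
           (auto simp: weibull weibull_df_def eventually_at_filter)
      moreover have "(G \<longlongrightarrow> 1) (at_right 0)"
        by (rule Lim_transform_eventually[OF tendsto_const])
           (auto simp: weibull weibull_df_def eventually_at_filter)
      moreover have "G 0 = 1" using \<alpha> by (simp add: weibull weibull_df_def)
      ultimately have 4: "isCont G 0" by (simp add: isCont_def filterlim_split_at_real)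
      show ?thesis
        using 1 2 4 continuous_on_eq_continuous_at[of "{0<..}" G] continuous_on_eq_continuous_at[of "{..<0}" G]
        by (cases x "0::real" rule: linorder_cases) auto
    qed
    moreover have "(G \<longlongrightarrow> 1) at_top"
      by (rule Lim_transform_eventually[OF tendsto_const])
         (auto simp: weibull weibull_df_def eventually_at_top_dense intro!: exI[of _ 0])
    moreover have "((\<lambda>x. exp (- ((- x) powr \<alpha>))) \<longlongrightarrow> 0) at_bot"
      using \<alpha> by real_asymp
    then have "(G \<longlongrightarrow> 0) at_bot"
      by (rule Lim_transform_eventually)
         (auto simp: weibull weibull_df_def eventually_at_bot_linorder intro!: exI[of _ 0])
    ultimately show ?thesis by blast
  qed
  then show "mono G" "isCont G x" "(G \<longlongrightarrow> 0) at_bot" "(G \<longlongrightarrow> 1) at_top" by auto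
qed

lemma df_from_continuous_mono:
  assumes mono: "mono G" and cont: "\<And>x. isCont G x"
    and bot: "(G \<longlongrightarrow> 0) at_bot" and top: "(G \<longlongrightarrow> 1) at_top"
  shows "real_distribution (interval_measure G)" and "cdf (interval_measure G) = G"
proof -
  have right: "continuous (at_right x) G" for x
    using cont by (rule continuous_at_imp_continuous_at_within)
  show "real_distribution (interval_measure G)"
    by (rule real_distribution_interval_measure[OF monoD[OF mono] right bot top])
  show "cdf (interval_measure G) = G"
    by (rule cdf_interval_measure[OF monoD[OF mono] right bot])
qed

lemma real_distribution_convolution:
  assumes "real_distribution \<mu>" "real_distribution \<nu>"
  shows "real_distribution (convolution \<mu> \<nu>)"
proof -
  interpret \<mu>: real_distribution \<mu> by fact
  interpret \<nu>: real_distribution \<nu> by fact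
  interpret P: pair_prob_space \<mu> \<nu> ..
  show ?thesis unfolding convolution_def by (intro P.real_distribution_distr) simp
qed

lemma char_convolution:
  assumes "real_distribution \<mu>" "real_distribution \<nu>"
  shows "char (convolution \<mu> \<nu>) t = char \<mu> t * char \<nu> t"
proof -
  interpret \<mu>: real_distribution \<mu> by fact
  interpret \<nu>: real_distribution \<nu> by fact
  interpret P: pair_prob_space \<mu> \<nu> ..
  have "char (convolution \<mu> \<nu>) t = integral\<^sup>L (\<mu> \<Otimes>\<^sub>M \<nu>) (\<lambda>z. iexp (t * (fst z + snd z)))"
    unfolding char_def convolution_def by (subst integral_distr) (auto simp: split_beta)
  also have "\<dots> = (LINT x|\<mu>. LINT y|\<nu>. iexp (t * (x + y)))"
    by (subst P.integral_fst'[symmetric]) (auto intro!: P.integrable_const_bound[of _ 1])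
  also have "\<dots> = (LINT x|\<mu>. LINT y|\<nu>. iexp (t * x) * iexp (t * y))"
    by (simp add: exp_add[symmetric] algebra_simps)
  also have "\<dots> = char \<mu> t * char \<nu> t"
    by (simp add: char_def)
  finally show ?thesis .
qed

text \<open>
  Both values come from Fubini: without atoms, \<open>\<mu> {..<t - y} = \<mu> {..t - y}\<close> and \<open>\<mu> {t - y} = 0\<close>. The second
  makes \<open>t\<close> a continuity point, so that the strict inequality in the limit law is harmless.
\<close>

lemma convolution_lessThan:
  fixes \<mu> :: "real measure"
  assumes "real_distribution \<mu>" and cont: "\<And>x. isCont (cdf \<mu>) x"
  shows "measure (convolution \<mu> \<mu>) {..<t} = (LINT y|\<mu>. cdf \<mu> (t - y))"
    and "measure (convolution \<mu> \<mu>) {t} = 0"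
proof -
  interpret \<mu>: real_distribution \<mu> by fact
  have atom: "measure \<mu> {x} = 0" for x using cont \<mu>.isCont_cdf by auto
  have lt: "measure \<mu> {..<x} = cdf \<mu> x" for x
  proof -
    have "measure \<mu> ({..<x} \<union> {x}) = measure \<mu> {..<x} + measure \<mu> {x}"
      by (intro \<mu>.finite_measure_Union) auto
    moreover have "{..<x} \<union> {x} = {..x}" by auto
    ultimately show ?thesis by (simp add: atom cdf_def)
  qed
  have [measurable]: "cdf \<mu> \<in> borel_measurable borel"
    using cont by (auto intro!: borel_measurable_continuous_onI continuous_at_imp_continuous_on)
  have *: "emeasure (convolution \<mu> \<mu>) A = (\<integral>\<^sup>+x. emeasure \<mu> {a. a + x \<in> A} \<partial>\<mu>)" if "A \<in> sets borel" for A
    using that by (intro convolution_emeasure) (auto intro: \<mu>.finite_measure_axioms)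
  have int: "integrable \<mu> (\<lambda>y. cdf \<mu> (t - y))"
    by (rule \<mu>.integrable_const_bound[of _ 1]) (auto simp: \<mu>.cdf_nonneg \<mu>.cdf_bounded_prob)
  have "emeasure (convolution \<mu> \<mu>) {..<t} = (\<integral>\<^sup>+x. ennreal (cdf \<mu> (t - x)) \<partial>\<mu>)"
  proof (subst *)
    have "{a. a + x \<in> {..<t}} = {..<t - x}" for x :: real by auto
    then show "(\<integral>\<^sup>+x. emeasure \<mu> {a. a + x \<in> {..<t}} \<partial>\<mu>) = (\<integral>\<^sup>+x. ennreal (cdf \<mu> (t - x)) \<partial>\<mu>)"
      by (simp add: \<mu>.emeasure_eq_measure lt)
  qed simp
  also have "\<dots> = ennreal (LINT y|\<mu>. cdf \<mu> (t - y))"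
    using int by (intro nn_integral_eq_integral) (auto simp: \<mu>.cdf_nonneg)
  finally show "measure (convolution \<mu> \<mu>) {..<t} = (LINT y|\<mu>. cdf \<mu> (t - y))"
    by (simp add: measure_def integral_nonneg_AE \<mu>.cdf_nonneg)
  have "emeasure (convolution \<mu> \<mu>) {t} = (\<integral>\<^sup>+x. 0 \<partial>\<mu>)"
  proof (subst *)
    have "{a. a + x \<in> {t}} = {t - x}" for x :: real by auto
    then show "(\<integral>\<^sup>+x. emeasure \<mu> {a. a + x \<in> {t}} \<partial>\<mu>) = (\<integral>\<^sup>+x. 0 \<partial>\<mu>)"
      by (simp add: \<mu>.emeasure_eq_measure atom)
  qed simp
  then show "measure (convolution \<mu> \<mu>) {t} = 0" by (simp add: measure_def)
qed

section \<open>The limit theorem for the minimax estimator\<close>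

theorem theorem3:
  fixes V :: "real^'q^'q"
    and \<theta> :: "real^'q"
    and M :: "'a measure"
    and F :: "real \<Rightarrow> real"
    and \<epsilon> :: "nat \<Rightarrow> 'a \<Rightarrow> real"
    and I :: "nat \<Rightarrow> 'q \<Rightarrow> nat set"
    and x :: "nat \<Rightarrow> nat \<Rightarrow> real^'q"
    and y :: "nat \<Rightarrow> nat \<Rightarrow> 'a \<Rightarrow> real"
  assumes distinct_rows: "inj (\<lambda>l. V $ l)"
    and det_nz: "det V \<noteq> 0"
    and prob: "prob_space M"
    and indep: "prob_space.indep_vars M (\<lambda>_. borel) \<epsilon> {1..}"
    and distr: "\<And>j. j \<ge> 1 \<Longrightarrow> cdf (distr M borel (\<epsilon> j)) = F"
    and I_disj: "\<And>n. n \<ge> 1 \<Longrightarrow> disjoint_family (I n)"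
    and I_union: "\<And>n. n \<ge> 1 \<Longrightarrow> (\<Union>l. I n l) = {1..CARD('q) * n}"
    and I_card: "\<And>n l. n \<ge> 1 \<Longrightarrow> card (I n l) = n"
    and design: "\<And>n l j. n \<ge> 1 \<Longrightarrow> j \<in> I n l \<Longrightarrow> x n j = V $ l"
    and model: "\<And>n j \<omega>. n \<ge> 1 \<Longrightarrow> j \<in> {1..CARD('q) * n} \<Longrightarrow> \<omega> \<in> space M \<Longrightarrow>
                  y n j \<omega> = (\<Sum>i\<in>UNIV. \<theta> $ i * x n j $ i) + \<epsilon> j \<omega>"
  shows
    "(\<forall>n\<ge>1. \<forall>T. minimax_estimator M (CARD('q) * n) (x n) (y n) T \<longrightarrow>
        (\<forall>\<omega>\<in>space M. max_residual (CARD('q) * n) (x n) (\<lambda>j. y n j \<omega>) (T \<omega>)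
           = 1 / 2 * Max (range (\<lambda>l. sample_range (\<lambda>j. \<epsilon> j \<omega>) (I n l))))) \<and>
     (\<exists>T.
        (\<forall>n\<ge>1. minimax_estimator M (CARD('q) * n) (x n) (y n) (T n) \<and>
           (\<forall>\<omega>\<in>space M. \<forall>i. T n \<omega> $ i - \<theta> $ i =
              det (replace_column V i (\<lambda>l. sample_midrange (\<lambda>j. \<epsilon> j \<omega>) (I n l))) / det V)) \<and>
        (\<forall>a b G.
           (\<forall>j\<ge>1. distr M borel (\<epsilon> j) = distr M borel (\<lambda>\<omega>. - \<epsilon> j \<omega>)) \<and>
           (\<forall>n\<ge>1. b n > 0) \<and>
           extreme_value_df G \<and>
           weak_conv (\<lambda>n. cdf (distr M borel (\<lambda>\<omega>. b n * (Max ((\<lambda>j. \<epsilon> j \<omega>) ` {1..n}) - a n)))) G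
           \<longrightarrow>
           (\<forall>t. (\<lambda>n. measure M {\<omega> \<in> space M.
                   2 * b n * (max_residual (CARD('q) * n) (x n) (\<lambda>j. y n j \<omega>) (T n \<omega>) - a n) < t})
                \<longlonglongrightarrow> df_self_convolution G t ^ CARD('q)) \<and>
           (\<forall>i. \<forall>(M' :: 'b measure) \<zeta> \<zeta>'.
              prob_space M' \<and>
              prob_space.indep_vars M' (\<lambda>_. borel) (case_sum \<zeta> \<zeta>') (UNIV :: ('q + 'q) set) \<and>
              (\<forall>l. cdf (distr M' borel (\<zeta> l)) = G \<and> cdf (distr M' borel (\<zeta>' l)) = G) \<longrightarrow>
              weak_conv_m
                (\<lambda>n. distr M borel (\<lambda>\<omega>. 2 * b n * (T n \<omega> $ i - \<theta> $ i)))
                (distr M' borel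
                   (\<lambda>\<omega>. det (replace_column V i (\<lambda>l. \<zeta> l \<omega> - \<zeta>' l \<omega>)) / det V)))))"
proof -
  interpret prob_space M by (rule prob)
  have rv[measurable]: "random_variable borel (\<epsilon> j)" if "j \<ge> 1" for j
    using indep that by (auto simp: indep_vars_def)
  have blk: "finite (I n l)" "I n l \<noteq> {}" "I n l \<subseteq> {1..}" "I n l \<subseteq> {1..CARD('q) * n}" if "n \<ge> 1" for n l
  proof -
    show "finite (I n l)" "I n l \<noteq> {}"
      using I_card[OF that, of l] that card_gt_0_iff[of "I n l"] by simp_all
    show "I n l \<subseteq> {1..CARD('q) * n}" using I_union[OF that] by blast
    then show "I n l \<subseteq> {1..}" by auto
  qed
  have y_block: "y n j \<omega> = (V *v \<theta>) $ l + \<epsilon> j \<omega>" if "n \<ge> 1" "j \<in> I n l" "\<omega> \<in> space M" for n j l \<omega>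
  proof -
    have "j \<in> {1..CARD('q) * n}" using blk(4)[OF that(1)] that(2) by blast
    then show ?thesis
      using model[OF that(1) _ that(3)] design[OF that(1,2)]
      by (simp add: matrix_vector_mult_def mult.commute)
  qed
  have range_y: "sample_range (\<lambda>j. y n j \<omega>) (I n l) = sample_range (\<lambda>j. \<epsilon> j \<omega>) (I n l)"
    if "n \<ge> 1" "\<omega> \<in> space M" for n l \<omega>
    by (rule sample_range_shift[OF blk(1)[OF that(1)] blk(2)[OF that(1)] y_block[OF that(1) _ that(2)]])
  have midrange_y: "sample_midrange (\<lambda>j. y n j \<omega>) (I n l) = (V *v \<theta>) $ l + sample_midrange (\<lambda>j. \<epsilon> j \<omega>) (I n l)"
    if "n \<ge> 1" "\<omega> \<in> space M" for n l \<omega>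
    by (rule sample_midrange_shift[OF blk(1)[OF that(1)] blk(2)[OF that(1)] y_block[OF that(1) _ that(2)]])
  obtain B :: "real^'q^'q" where BV: "B ** V = mat 1"
    and B: "\<And>i c. det (replace_column V i c) / det V = (\<Sum>l\<in>UNIV. B $ i $ l * c l)"
    using det_replace_column_linear[OF det_nz] by blast
  \<comment> \<open>The estimator that fits all midranges simultaneously, as a function of the observations.\<close>
  define g where "g n z = (\<chi> i. det (replace_column V i (\<lambda>l. sample_midrange z (I n l))) / det V)" for n z
  define T where "T n \<omega> = g n (\<lambda>j\<in>{1..CARD('q) * n}. y n j \<omega>)" for n \<omega>
  \<comment> \<open>A midrange reads only the indices of its block, so restricting the observations changes nothing.\<close>
  have T_y: "T n \<omega> = g n (\<lambda>j. y n j \<omega>)" if "n \<ge> 1" for n \<omega>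
  proof -
    have "(\<lambda>j\<in>{1..CARD('q) * n}. y n j \<omega>) ` I n l = (\<lambda>j. y n j \<omega>) ` I n l" for l
      using blk(4)[OF that, of l] by (intro image_cong) auto
    then show ?thesis by (simp add: T_def g_def sample_midrange_def)
  qed
  have T_fit: "(V *v T n \<omega>) $ l = sample_midrange (\<lambda>j. y n j \<omega>) (I n l)" if "n \<ge> 1" for n \<omega> l
    by (simp add: T_y[OF that] g_def cramer_replace_column[OF det_nz])
  have T_error: "T n \<omega> $ i - \<theta> $ i = det (replace_column V i (\<lambda>l. sample_midrange (\<lambda>j. \<epsilon> j \<omega>) (I n l))) / det V"
    if "n \<ge> 1" "\<omega> \<in> space M" for n \<omega> i
  proof -
    have "(\<Sum>l\<in>UNIV. B $ i $ l * (V *v \<theta>) $ l) = (B *v (V *v \<theta>)) $ i"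
      by (simp add: matrix_vector_mult_def)
    also have "\<dots> = \<theta> $ i" by (simp add: matrix_vector_mul_assoc BV)
    finally show ?thesis
      by (simp add: T_y[OF that(1)] g_def B midrange_y[OF that] distrib_left sum.distrib)
  qed
  have residual_T: "max_residual (CARD('q) * n) (x n) (\<lambda>j. y n j \<omega>) (T n \<omega>)
      = 1 / 2 * Max (range (\<lambda>l. sample_range (\<lambda>j. \<epsilon> j \<omega>) (I n l)))" if "n \<ge> 1" "\<omega> \<in> space M" for n \<omega>
    using max_residual_midrange_fit[OF I_union[OF that(1)] blk(2)[OF that(1)] design[OF that(1)] T_fit[OF that(1)]]
    by (simp add: range_y[OF that])
  have residual_ge: "1 / 2 * Max (range (\<lambda>l. sample_range (\<lambda>j. \<epsilon> j \<omega>) (I n l)))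
      \<le> max_residual (CARD('q) * n) (x n) (\<lambda>j. y n j \<omega>) \<tau>" if "n \<ge> 1" "\<omega> \<in> space M" for n \<omega> \<tau>
    using max_residual_ge_half_range[OF I_union[OF that(1)] blk(2)[OF that(1)] design[OF that(1)]]
    by (simp only: range_y[OF that, symmetric])
  have T_minimax: "minimax_estimator M (CARD('q) * n) (x n) (y n) (T n)" if "n \<ge> 1" for n
    unfolding minimax_estimator_def
  proof (intro conjI bexI ballI allI)
    show "g n \<in> borel_measurable (Pi\<^sub>M {1..CARD('q) * n} (\<lambda>_. borel))"
    proof (subst borel_measurable_euclidean_space, intro ballI)
      fix v :: "real^'q" assume "v \<in> Basis"
      then obtain i where v: "v = axis i 1" by (auto simp: Basis_vec_def)
      have mid: "(\<lambda>z. sample_midrange z (I n l)) \<in> borel_measurable (Pi\<^sub>M {1..CARD('q) * n} (\<lambda>_. borel))" for l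
        unfolding sample_midrange_def using blk[OF that, of l]
        by (intro borel_measurable_divide borel_measurable_add borel_measurable_Max borel_measurable_Min)
           (auto intro!: measurable_component_singleton)
      show "(\<lambda>z. g n z \<bullet> v) \<in> borel_measurable (Pi\<^sub>M {1..CARD('q) * n} (\<lambda>_. borel))"
      proof -
        have "(\<lambda>z. g n z \<bullet> v) = (\<lambda>z. \<Sum>l\<in>UNIV. B $ i $ l * sample_midrange z (I n l))"
          by (simp add: v inner_axis g_def B)
        then show ?thesis
          by (simp only:) (intro borel_measurable_sum borel_measurable_times borel_measurable_const mid)
      qed
    qed
    show "T n \<omega> = g n (\<lambda>j\<in>{1..CARD('q) * n}. y n j \<omega>)" for \<omega>
      by (rule T_def)
    show "max_residual (CARD('q) * n) (x n) (\<lambda>j. y n j \<omega>) (T n \<omega>)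
        \<le> max_residual (CARD('q) * n) (x n) (\<lambda>j. y n j \<omega>) \<tau>" if "\<omega> \<in> space M" for \<omega> \<tau>
      unfolding residual_T[OF \<open>n \<ge> 1\<close> that] by (rule residual_ge[OF \<open>n \<ge> 1\<close> that])
  qed
  have part_i: "max_residual (CARD('q) * n) (x n) (\<lambda>j. y n j \<omega>) (S \<omega>)
      = 1 / 2 * Max (range (\<lambda>l. sample_range (\<lambda>j. \<epsilon> j \<omega>) (I n l)))"
    if "n \<ge> 1" "minimax_estimator M (CARD('q) * n) (x n) (y n) S" "\<omega> \<in> space M" for n S \<omega>
  proof (rule antisym)
    show "max_residual (CARD('q) * n) (x n) (\<lambda>j. y n j \<omega>) (S \<omega>)
        \<le> 1 / 2 * Max (range (\<lambda>l. sample_range (\<lambda>j. \<epsilon> j \<omega>) (I n l)))"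
      using that unfolding residual_T[OF that(1,3), symmetric] minimax_estimator_def by blast
  qed (rule residual_ge[OF that(1,3)])
  have part_ii: "(\<forall>t. (\<lambda>n. prob {\<omega> \<in> space M.
          2 * b n * (max_residual (CARD('q) * n) (x n) (\<lambda>j. y n j \<omega>) (T n \<omega>) - a n) < t})
        \<longlonglongrightarrow> df_self_convolution G t ^ CARD('q)) \<and>
      (\<forall>i. \<forall>(M' :: 'b measure) \<zeta> \<zeta>'.
        prob_space M' \<and> prob_space.indep_vars M' (\<lambda>_. borel) (case_sum \<zeta> \<zeta>') (UNIV :: ('q + 'q) set) \<and>
        (\<forall>l. cdf (distr M' borel (\<zeta> l)) = G \<and> cdf (distr M' borel (\<zeta>' l)) = G) \<longrightarrow>
        weak_conv_m (\<lambda>n. distr M borel (\<lambda>\<omega>. 2 * b n * (T n \<omega> $ i - \<theta> $ i)))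
          (distr M' borel (\<lambda>\<omega>. det (replace_column V i (\<lambda>l. \<zeta> l \<omega> - \<zeta>' l \<omega>)) / det V)))"
    if sym: "\<forall>j\<ge>1. distr M borel (\<epsilon> j) = distr M borel (\<lambda>\<omega>. - \<epsilon> j \<omega>)" and b: "\<forall>n\<ge>1. b n > 0"
      and G: "extreme_value_df G"
      and max_conv: "weak_conv (\<lambda>n. cdf (distr M borel (\<lambda>\<omega>. b n * (Max ((\<lambda>j. \<epsilon> j \<omega>) ` {1..n}) - a n)))) G"
    for a b :: "nat \<Rightarrow> real" and G
  proof -
    define \<mu> where "\<mu> = interval_measure G"
    note G_reg = extreme_value_df_regular[OF G]
    have \<mu>: "real_distribution \<mu>" and cdf_\<mu>: "cdf \<mu> = G"
      unfolding \<mu>_def by (rule df_from_continuous_mono[OF G_reg])+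
    \<comment> \<open>Everything below is indexed by \<open>n + 1\<close>: at sample size \<open>0\<close> there is no data and \<open>b 0\<close> may be anything.\<close>
    define X where "X n l \<omega> = b (Suc n) * (Max ((\<lambda>j. \<epsilon> j \<omega>) ` I (Suc n) l) - a (Suc n))" for n l \<omega>
    define Y where "Y n l \<omega> = b (Suc n) * (- Min ((\<lambda>j. \<epsilon> j \<omega>) ` I (Suc n) l) - a (Suc n))" for n l \<omega>
    have b_pos: "0 < b (Suc n)" for n using b by simp
    have lim: "(\<lambda>n. F (a (Suc n) + u / b (Suc n)) ^ Suc n) \<longlonglongrightarrow> cdf \<mu> u" for u
    proof -
      have "(\<lambda>n. cdf (distr M borel (\<lambda>\<omega>. b n * (Max ((\<lambda>j. \<epsilon> j \<omega>) ` {1..n}) - a n))) u) \<longlonglongrightarrow> G u"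
        using max_conv G_reg(2) by (auto simp: weak_conv_def)
      moreover have "cdf (distr M borel (\<lambda>\<omega>. b (Suc n) * (Max ((\<lambda>j. \<epsilon> j \<omega>) ` {1..Suc n}) - a (Suc n)))) u
          = F (a (Suc n) + u / b (Suc n)) ^ Suc n" for n
      proof -
        have [measurable]: "random_variable borel (\<lambda>\<omega>. b (Suc n) * (Max ((\<lambda>j. \<epsilon> j \<omega>) ` {1..Suc n}) - a (Suc n)))"
          by (intro borel_measurable_times borel_measurable_diff borel_measurable_Max) (auto intro: rv)
        have "cdf (distr M borel (\<lambda>\<omega>. b (Suc n) * (Max ((\<lambda>j. \<epsilon> j \<omega>) ` {1..Suc n}) - a (Suc n)))) u
            = prob {\<omega>\<in>space M. b (Suc n) * (Max ((\<lambda>j. \<epsilon> j \<omega>) ` {1..Suc n}) - a (Suc n)) \<le> u}"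
          by (auto simp: cdf_def measure_distr intro!: arg_cong[where f = prob])
        also have "\<dots> = F (a (Suc n) + u / b (Suc n)) ^ card {1..Suc n}"
          by (rule prob_block_extremes(1)[OF indep]) (use distr sym b_pos in auto)
        finally show ?thesis by simp
      qed
      ultimately show ?thesis by (auto dest: LIMSEQ_Suc simp: cdf_\<mu>)
    qed
    have fin: "finite (I (Suc n) l)" for n l
      by (rule blk) simp
    have rv_blk: "random_variable borel (\<epsilon> j)" if "j \<in> I (Suc n) l" for n l j
      using blk(3)[of "Suc n" l] that by (intro rv) auto
    have X_rv[measurable]: "random_variable borel (X n l)" and Y_rv[measurable]: "random_variable borel (Y n l)" for n l
      unfolding X_def[abs_def] Y_def[abs_def]
      by (intro borel_measurable_times borel_measurable_const borel_measurable_diff borel_measurable_uminus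
          borel_measurable_Max borel_measurable_Min fin rv_blk; assumption)+
    have char_XY: "(\<lambda>n. char (distr M borel (\<lambda>\<omega>. p * X n l \<omega> + q * Y n l \<omega>)) t) \<longlonglongrightarrow> char \<mu> (t * p) * char \<mu> (t * q)" for p q t l
      unfolding X_def Y_def
      by (rule char_block_extremes_tendsto[OF indep _ _ _ _ _ b_pos \<mu> lim])
         (use blk I_card distr sym in auto)
    have block_indep: "indep_vars (\<lambda>_. borel) (\<lambda>l \<omega>. p l * X n l \<omega> + q l * Y n l \<omega>) UNIV" for p q n
    proof -
      have "indep_vars (\<lambda>_. borel) (\<lambda>l \<omega>. (\<lambda>z. p l * (b (Suc n) * (Max (z ` I (Suc n) l) - a (Suc n)))
          + q l * (b (Suc n) * (- Min (z ` I (Suc n) l) - a (Suc n)))) (\<lambda>j. \<epsilon> j \<omega>)) UNIV"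
      proof (rule indep_vars_of_disjoint_blocks[OF indep])
        show "disjoint_family (I (Suc n))" by (rule I_disj) simp
        show "I (Suc n) l \<subseteq> {1..}" for l by (rule blk) simp
        show "(\<lambda>z. p l * (b (Suc n) * (Max (z ` I (Suc n) l) - a (Suc n)))
            + q l * (b (Suc n) * (- Min (z ` I (Suc n) l) - a (Suc n)))) \<in> borel_measurable (Pi\<^sub>M (I (Suc n) l) (\<lambda>_. borel))" for l
          using blk(1)[of "Suc n" l]
          by (intro borel_measurable_add borel_measurable_times borel_measurable_diff borel_measurable_uminus
              borel_measurable_Max borel_measurable_Min) auto
      qed simp
      then show ?thesis by (simp add: X_def Y_def)
    qed
    \<comment> \<open>The minimax residual is half of the largest range, so the event is an intersection of one event per block.\<close>
    have first: "(\<lambda>n. prob {\<omega> \<in> space M.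
          2 * b n * (max_residual (CARD('q) * n) (x n) (\<lambda>j. y n j \<omega>) (T n \<omega>) - a n) < t})
        \<longlonglongrightarrow> df_self_convolution G t ^ CARD('q)" for t
    proof (rule LIMSEQ_imp_Suc)
      have one: "(\<lambda>n. prob {\<omega>\<in>space M. X n l \<omega> + Y n l \<omega> < t}) \<longlonglongrightarrow> df_self_convolution G t" for l
      proof -
        have conv: "real_distribution (convolution \<mu> \<mu>)" by (rule real_distribution_convolution[OF \<mu> \<mu>])
        interpret C: real_distribution "convolution \<mu> \<mu>" by (rule conv)
        have rd: "real_distribution (distr M borel (\<lambda>\<omega>. X n l \<omega> + Y n l \<omega>))" for n by simp
        have weak: "weak_conv_m (\<lambda>n. distr M borel (\<lambda>\<omega>. X n l \<omega> + Y n l \<omega>)) (convolution \<mu> \<mu>)"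
          using char_XY[of 1 l 1] by (intro levy_continuity[OF rd conv]) (simp add: char_convolution[OF \<mu> \<mu>])
        have conv_t: "measure (convolution \<mu> \<mu>) {..<t} = df_self_convolution G t" "measure (convolution \<mu> \<mu>) {t} = 0"
          using convolution_lessThan[OF \<mu>, of t, unfolded cdf_\<mu>, OF G_reg(2)]
          by (simp_all only: df_self_convolution_def \<mu>_def)
        have "(\<lambda>n. measure (distr M borel (\<lambda>\<omega>. X n l \<omega> + Y n l \<omega>)) {..<t}) \<longlonglongrightarrow> measure (convolution \<mu> \<mu>) {..<t}"
        proof (rule weak_conv_imp_continuity_set_conv[OF rd conv weak])
          have "frontier {..<t} = {t}" by (auto simp: frontier_def interior_open)
          then show "emeasure (convolution \<mu> \<mu>) (frontier {..<t}) = 0"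
            by (simp add: conv_t C.emeasure_eq_measure)
        qed simp
        moreover have "measure (distr M borel (\<lambda>\<omega>. X n l \<omega> + Y n l \<omega>)) {..<t} = prob {\<omega>\<in>space M. X n l \<omega> + Y n l \<omega> < t}" for n
          by (auto simp: measure_distr intro!: arg_cong[where f = prob])
        ultimately show ?thesis by (simp add: conv_t)
      qed
      have "prob {\<omega> \<in> space M. 2 * b (Suc n) *
            (max_residual (CARD('q) * Suc n) (x (Suc n)) (\<lambda>j. y (Suc n) j \<omega>) (T (Suc n) \<omega>) - a (Suc n)) < t}
          = (\<Prod>l\<in>UNIV. prob {\<omega>\<in>space M. X n l \<omega> + Y n l \<omega> < t})" for n
      proof -
        have res: "2 * b (Suc n) * (max_residual (CARD('q) * Suc n) (x (Suc n)) (\<lambda>j. y (Suc n) j \<omega>) (T (Suc n) \<omega>) - a (Suc n)) < t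
            \<longleftrightarrow> (\<forall>l. X n l \<omega> + Y n l \<omega> < t)" if "\<omega> \<in> space M" for \<omega>
        proof -
          let ?R = "\<lambda>l. sample_range (\<lambda>j. \<epsilon> j \<omega>) (I (Suc n) l)"
          have "2 * b (Suc n) * (1 / 2 * Max (range ?R) - a (Suc n)) < t \<longleftrightarrow> Max (range ?R) < t / b (Suc n) + 2 * a (Suc n)"
          proof -
            have "2 * b (Suc n) * (1 / 2 * Max (range ?R) - a (Suc n)) = (Max (range ?R) - 2 * a (Suc n)) * b (Suc n)"
              by (simp only: left_diff_distrib right_diff_distrib) simp
            then show ?thesis
              by (simp only: pos_less_divide_eq[OF b_pos, symmetric] diff_less_eq)
          qed
          also have "\<dots> \<longleftrightarrow> (\<forall>l. ?R l < t / b (Suc n) + 2 * a (Suc n))" by simp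
          also have "\<dots> \<longleftrightarrow> (\<forall>l. X n l \<omega> + Y n l \<omega> < t)"
            using b_pos[of n] by (simp add: X_def Y_def sample_range_def field_simps)
          finally show ?thesis by (simp only: residual_T[OF _ that] le_add1 plus_1_eq_Suc[symmetric])
        qed
        have "prob (\<Inter>l\<in>UNIV. (\<lambda>\<omega>. 1 * X n l \<omega> + 1 * Y n l \<omega>) -` {..<t} \<inter> space M)
            = (\<Prod>l\<in>UNIV. prob ((\<lambda>\<omega>. 1 * X n l \<omega> + 1 * Y n l \<omega>) -` {..<t} \<inter> space M))"
          by (rule indep_varsD_finite[OF block_indep]) auto
        moreover have "(\<Inter>l\<in>UNIV. (\<lambda>\<omega>. 1 * X n l \<omega> + 1 * Y n l \<omega>) -` {..<t} \<inter> space M) = {\<omega> \<in> space M. 2 * b (Suc n) *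
            (max_residual (CARD('q) * Suc n) (x (Suc n)) (\<lambda>j. y (Suc n) j \<omega>) (T (Suc n) \<omega>) - a (Suc n)) < t}"
          using res by auto
        moreover have "(\<lambda>\<omega>. 1 * X n l \<omega> + 1 * Y n l \<omega>) -` {..<t} \<inter> space M = {\<omega>\<in>space M. X n l \<omega> + Y n l \<omega> < t}" for l
          by auto
        ultimately show ?thesis by simp
      qed
      moreover have "(\<lambda>n. \<Prod>l\<in>(UNIV :: 'q set). prob {\<omega>\<in>space M. X n l \<omega> + Y n l \<omega> < t}) \<longlonglongrightarrow> (\<Prod>l\<in>(UNIV :: 'q set). df_self_convolution G t)"
        by (intro tendsto_prod one)
      ultimately show "(\<lambda>n. prob {\<omega> \<in> space M. 2 * b (Suc n) *
            (max_residual (CARD('q) * Suc n) (x (Suc n)) (\<lambda>j. y (Suc n) j \<omega>) (T (Suc n) \<omega>) - a (Suc n)) < t})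
          \<longlonglongrightarrow> df_self_convolution G t ^ CARD('q)" by simp
    qed
    have second: "weak_conv_m (\<lambda>n. distr M borel (\<lambda>\<omega>. 2 * b n * (T n \<omega> $ i - \<theta> $ i)))
          (distr M' borel (\<lambda>\<omega>. det (replace_column V i (\<lambda>l. \<zeta> l \<omega> - \<zeta>' l \<omega>)) / det V))"
      if M': "prob_space M'" and ind: "prob_space.indep_vars M' (\<lambda>_. borel) (case_sum \<zeta> \<zeta>') (UNIV :: ('q + 'q) set)"
        and law: "\<And>l. cdf (distr M' borel (\<zeta> l)) = G" "\<And>l. cdf (distr M' borel (\<zeta>' l)) = G"
      for i and M' :: "'b measure" and \<zeta> \<zeta>'
    proof -
      interpret M': prob_space M' by (rule M')
      have rv': "M'.random_variable borel (case_sum \<zeta> \<zeta>' k)" for k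
        using ind by (auto simp: M'.indep_vars_def)
      have \<zeta>_rv[measurable]: "M'.random_variable borel (\<zeta> l)" "M'.random_variable borel (\<zeta>' l)" for l
        using rv'[of "Inl l"] rv'[of "Inr l"] by auto
      have law_\<mu>: "distr M' borel (\<zeta> l) = \<mu>" "distr M' borel (\<zeta>' l) = \<mu>" for l
        by (rule cdf_unique; simp add: \<mu> law cdf_\<mu>)+
      have sum_UNIV: "sum f UNIV = (\<Sum>l\<in>UNIV. f (Inl l)) + (\<Sum>l\<in>UNIV. f (Inr l))" for f :: "'q + 'q \<Rightarrow> real"
        using sum.Plus[of UNIV UNIV f] by (simp add: comp_def)
      have prod_UNIV: "prod f UNIV = (\<Prod>l\<in>UNIV. f (Inl l)) * (\<Prod>l\<in>UNIV. f (Inr l))" for f :: "'q + 'q \<Rightarrow> complex"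
        using prod.Plus[of UNIV UNIV f] by (simp add: comp_def)
      \<comment> \<open>By linearity of the Cramer quotient the scaled error and its limit are sums of independent terms.\<close>
      define S where "S n \<omega> = (\<Sum>l\<in>UNIV. B $ i $ l * X n l \<omega> + (- B $ i $ l) * Y n l \<omega>)" for n \<omega>
      define Z where "Z \<omega> = (\<Sum>k\<in>UNIV. case_sum (\<lambda>l. B $ i $ l) (\<lambda>l. - B $ i $ l) k * case_sum \<zeta> \<zeta>' k \<omega>)" for \<omega>
      have [measurable]: "random_variable borel (S n)" for n unfolding S_def[abs_def] by measurable
      have Z_rv[measurable]: "M'.random_variable borel Z"
        unfolding Z_def[abs_def] by (intro borel_measurable_sum borel_measurable_times rv') simp
      have Z: "det (replace_column V i (\<lambda>l. \<zeta> l \<omega> - \<zeta>' l \<omega>)) / det V = Z \<omega>" for \<omega>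
        unfolding B Z_def sum_UNIV sum.distrib[symmetric] by (simp add: algebra_simps)
      have S: "2 * b (Suc n) * (T (Suc n) \<omega> $ i - \<theta> $ i) = S n \<omega>" if "\<omega> \<in> space M" for n \<omega>
        unfolding T_error[of "Suc n", OF _ that, simplified] B S_def sum_distrib_left
        by (intro sum.cong refl) (simp add: X_def Y_def sample_midrange_def algebra_simps)
      \<comment> \<open>Both characteristic functions factor, and the factor of each block converges.\<close>
      have "weak_conv_m (\<lambda>n. distr M borel (S n)) (distr M' borel Z)"
      proof (rule levy_continuity)
        fix t
        have "(\<lambda>n. \<Prod>l\<in>UNIV. char (distr M borel (\<lambda>\<omega>. B $ i $ l * X n l \<omega> + (- B $ i $ l) * Y n l \<omega>)) t)
            \<longlonglongrightarrow> (\<Prod>l\<in>UNIV. char \<mu> (t * B $ i $ l) * char \<mu> (t * (- B $ i $ l)))"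
          by (intro tendsto_prod char_XY)
        also have "(\<lambda>n. \<Prod>l\<in>UNIV. char (distr M borel (\<lambda>\<omega>. B $ i $ l * X n l \<omega> + (- B $ i $ l) * Y n l \<omega>)) t)
            = (\<lambda>n. char (distr M borel (S n)) t)"
          unfolding S_def[abs_def] by (intro ext char_distr_sum[symmetric] block_indep)
        also have "(\<Prod>l\<in>UNIV. char \<mu> (t * B $ i $ l) * char \<mu> (t * (- B $ i $ l))) = char (distr M' borel Z) t"
        proof -
          have scaled: "char (distr M' borel (\<lambda>\<omega>. c * \<xi> \<omega>)) t = char \<mu> (t * c)"
            if [measurable]: "M'.random_variable borel \<xi>" and "distr M' borel \<xi> = \<mu>" for c \<xi>
            unfolding that(2)[symmetric] char_def by (simp add: integral_distr mult.assoc)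
          have "M'.indep_vars (\<lambda>_. borel) (\<lambda>k \<omega>. case_sum (\<lambda>l. B $ i $ l) (\<lambda>l. - B $ i $ l) k * case_sum \<zeta> \<zeta>' k \<omega>) UNIV"
            by (rule M'.indep_vars_compose2[OF ind]) simp
          then have "char (distr M' borel Z) t = (\<Prod>k\<in>UNIV. char (distr M' borel
              (\<lambda>\<omega>. case_sum (\<lambda>l. B $ i $ l) (\<lambda>l. - B $ i $ l) k * case_sum \<zeta> \<zeta>' k \<omega>)) t)"
            unfolding Z_def[abs_def] by (rule M'.char_distr_sum)
          also have "\<dots> = (\<Prod>l\<in>UNIV. char \<mu> (t * B $ i $ l)) * (\<Prod>l\<in>UNIV. char \<mu> (t * (- B $ i $ l)))"
            unfolding prod_UNIV by (simp only: sum.case scaled[OF \<zeta>_rv(1) law_\<mu>(1)] scaled[OF \<zeta>_rv(2) law_\<mu>(2)])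
          finally show ?thesis by (simp add: prod.distrib)
        qed
        finally show "(\<lambda>n. char (distr M borel (S n)) t) \<longlonglongrightarrow> char (distr M' borel Z) t" .
      qed simp_all
      moreover have "distr M borel (\<lambda>\<omega>. 2 * b (Suc n) * (T (Suc n) \<omega> $ i - \<theta> $ i)) = distr M borel (S n)" for n
        by (rule distr_cong) (auto simp: S)
      ultimately show ?thesis
        unfolding Z weak_conv_m_def weak_conv_def by (auto intro: LIMSEQ_imp_Suc)
    qed
    show ?thesis using first second by blast
  qed
  show ?thesis
  proof (rule conjI)
    show "\<forall>n\<ge>1. \<forall>S. minimax_estimator M (CARD('q) * n) (x n) (y n) S \<longrightarrow>
        (\<forall>\<omega>\<in>space M. max_residual (CARD('q) * n) (x n) (\<lambda>j. y n j \<omega>) (S \<omega>)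
           = 1 / 2 * Max (range (\<lambda>l. sample_range (\<lambda>j. \<epsilon> j \<omega>) (I n l))))"
      using part_i by blast
  qed (rule exI[of _ T], rule conjI, use T_minimax T_error in blast, intro allI impI, elim conjE, rule part_ii)
qed

end
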